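(* Let $k\ge 6$ and let $G$ be a planar (finite simple) graph with maximum degree $\Delta\le k$. If $G$ contains no cycle of length 5, then $\chi_{gl}''(G)\le k+2$.
   Context: Let $H$ be a graph with an arbitrary fixed orientation and $A$ a group written additively. For $f:E(H)\to A$ and a list assignment $L:V(H)\to 2^A$, an $(A,L,f)$-coloring of $H$ is a map $c:V(H)\to A$ with $c(v)\in L(v)$ for all $v$ and $c(x)-c(y)\neq f(xy)$ for every edge directed from $x$ to $y$. $H$ is $k$-group choosable if for every group $A$ with $|A|\ge k$, every list assignment $L$ with $|L(v)|=k$ for all $v$, and every $f:E(H)\to A$, an $(A,L,f)$-coloring exists; $\chi_{gl}(H)$ is the least such $k$. The total graph $T(G)$ has vertex set $V(G)\cup E(G)$, two elements adjacent iff they are adjacent or incident in $G$; $\chi_{gl}''(G)=\chi_{gl}(T(G))$. *)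

theory Defs
  imports "HOL-Analysis.Analysis" "HOL-Algebra.Group" "HOL-Library.Extended_Nat"
begin

definition simple_graph :: "'v set \<Rightarrow> 'v set set \<Rightarrow> bool" where
  "simple_graph V E \<longleftrightarrow> finite V \<and> (\<forall>e\<in>E. e \<subseteq> V \<and> card e = 2)"

definition vdegree :: "'v set set \<Rightarrow> 'v \<Rightarrow> nat" where
  "vdegree E v = card {e \<in> E. v \<in> e}"

(* Zero is inserted so that the graph without vertices has maximum degree 0. *)
definition max_degree :: "'v set \<Rightarrow> 'v set set \<Rightarrow> nat" where
  "max_degree V E = Max (insert 0 (vdegree E ` V))"

(* Cycles as (not necessarily induced) subgraphs; meaningful for n at least 3. *)
definition has_cycle_of_length :: "nat \<Rightarrow> 'v set set \<Rightarrow> bool" where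
  "has_cycle_of_length n E \<longleftrightarrow>
     (\<exists>vs. length vs = n \<and> distinct vs \<and> (\<forall>i<n. {vs ! i, vs ! (Suc i mod n)} \<in> E))"

(* A crossing-free drawing in the plane: p places the vertices, g draws the edges as simple arcs. *)
definition plane_drawing ::
    "'v set \<Rightarrow> 'v set set \<Rightarrow> ('v \<Rightarrow> complex) \<Rightarrow> ('v set \<Rightarrow> real \<Rightarrow> complex) \<Rightarrow> bool" where
  "plane_drawing V E p g \<longleftrightarrow>
     inj_on p V \<and>
     (\<forall>e\<in>E. arc (g e) \<and> {pathstart (g e), pathfinish (g e)} = p ` e \<and>
            path_image (g e) \<inter> p ` V = p ` e) \<and>
     (\<forall>e\<in>E. \<forall>e'\<in>E. e \<noteq> e' \<longrightarrow> path_image (g e) \<inter> path_image (g e') \<subseteq> p ` (e \<inter> e'))"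

definition planar :: "'v set \<Rightarrow> 'v set set \<Rightarrow> bool" where
  "planar V E \<longleftrightarrow> (\<exists>p g. plane_drawing V E p g)"

definition total_verts :: "'v set \<Rightarrow> 'v set set \<Rightarrow> ('v + 'v set) set" where
  "total_verts V E = V <+> E"

definition total_edges :: "'v set set \<Rightarrow> ('v + 'v set) set set" where
  "total_edges E =
     {{Inl u, Inl v} |u v. {u, v} \<in> E} \<union>
     {{Inr e, Inr e'} |e e'. e \<in> E \<and> e' \<in> E \<and> e \<noteq> e' \<and> e \<inter> e' \<noteq> {}} \<union>
     {{Inl v, Inr e} |v e. e \<in> E \<and> v \<in> e}"

(* D contains exactly one of the arcs (x, y), (y, x) for every edge {x, y}, and no other arcs. *)
definition orientation :: "'w set set \<Rightarrow> ('w \<times> 'w) set \<Rightarrow> bool" where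
  "orientation F D \<longleftrightarrow> bij_betw (\<lambda>(x, y). {x, y}) D F"

(* Groups need not be commutative; c(x) - c(y) in additive notation is
   c x \<otimes> inv (c y) in the multiplicative notation of HOL-Algebra. *)
definition group_coloring ::
    "'a monoid \<Rightarrow> ('w \<Rightarrow> 'a set) \<Rightarrow> ('w set \<Rightarrow> 'a) \<Rightarrow> 'w set \<Rightarrow> ('w \<times> 'w) set \<Rightarrow> ('w \<Rightarrow> 'a) \<Rightarrow> bool"
  where
  "group_coloring A L f W D c \<longleftrightarrow>
     (\<forall>v\<in>W. c v \<in> L v) \<and>
     (\<forall>(x, y)\<in>D. c x \<otimes>\<^bsub>A\<^esub> inv\<^bsub>A\<^esub> (c y) \<noteq> f {x, y})"

(* HOL cannot quantify over types inside a formula, so the groups considered are those whose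
   carrier consists of elements of the type 'a; "for every group" is obtained by leaving 'a
   arbitrary in theorems.  The notion does not depend on the orientation (replace f by its
   inverse on reversed edges), and all orientations are admitted. *)
definition group_choosable :: "'a itself \<Rightarrow> nat \<Rightarrow> 'w set \<Rightarrow> 'w set set \<Rightarrow> bool" where
  "group_choosable TYPE('a) k W F \<longleftrightarrow>
     (\<forall>(A :: 'a monoid) D L f.
        group A \<and> (infinite (carrier A) \<or> k \<le> card (carrier A)) \<and>
        orientation F D \<and>
        (\<forall>v\<in>W. L v \<subseteq> carrier A \<and> finite (L v) \<and> card (L v) = k) \<and>
        (\<forall>e\<in>F. f e \<in> carrier A)
        \<longrightarrow> (\<exists>c. group_coloring A L f W D c))"

(* The least k, and infinity if there is none.  A bound valid for every type 'a is the same
   as that bound for the group choice number over all groups, since k-group choosability is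
   monotone in k. *)
definition group_choice_number :: "'a itself \<Rightarrow> 'w set \<Rightarrow> 'w set set \<Rightarrow> enat" where
  "group_choice_number TYPE('a) W F = Inf {enat k |k. group_choosable TYPE('a) k W F}"

definition total_group_choice_number :: "'a itself \<Rightarrow> 'v set \<Rightarrow> 'v set set \<Rightarrow> enat" where
  "total_group_choice_number TYPE('a) V E =
     group_choice_number TYPE('a) (total_verts V E) (total_edges E)"

end

theory Submission
  imports Defs "HOL-Complex_Analysis.Winding_Numbers"
begin

text \<open>
  Every nonempty planar graph without 5-cycles has an edge \<open>uv\<close> with \<open>d(u) \<le> 2\<close>, or with \<open>d(u) = 3\<close>
  and \<open>d(v) \<le> 5\<close>. Deleting such an edge, colouring the rest, and then greedily colouring first the
  edge and then \<open>u\<close> anew proves the theorem by induction on the number of edges.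

  If there were no such edge, all degrees would be at least 3 and the neighbours of vertices of
  degree 3 would have degree at least 6. Take an end block, drawn in the plane. Give vertices the charge
  \<open>2 d(v) - 6\<close> and faces the charge \<open>length(f) - 6\<close>; by Euler's formula the total is -12. Without
  5-cycles a triangular face is not adjacent to a quadrangular face and around a vertex of
  degree at least 4 no three triangular faces are consecutive. Hence vertices can afford to pay
  for all triangles and quadrangles, up to a bounded loss of 8 at the cut vertex of the block: a contradiction.

  Faces are obtained from an ear decomposition of the block: an ear runs inside one face and
  splits it into two faces bounded by cycles.
\<close>

section \<open>Greedy colouring of total graphs\<close>

text \<open>The two charges vanish exactly at vertices of degree 3 and at faces of length 6. As no
  face has length 5, only triangles (lacking 3) and quadrangles (lacking 2) are in need. A vertex of
  degree 3 has nothing to give, so a small face at it relies on its two neighbours on the face, each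
  paying half; degree 6 is where the budget of a vertex allows this. That is the origin of the
  bounds 3 and 5 for the light edge.

  Discharging wants faces bounded by cycles, hence a 2-connected graph. In an end block only the cut
  vertex may have lost edges, so every other vertex keeps its degree and the damage is confined to
  one vertex.

  Topology enters only when cycles and ears are drawn. What survives is a finite incidence structure
  of faces and boundary lists. It does not record the cyclic order of the faces around a vertex,
  only its connectedness: no proper nonempty set of edges at a vertex is closed under passing to the
  other edge of the same face at that vertex.\<close>

lemma total_edges_iff:
  "{Inl u, Inl v} \<in> total_edges E \<longleftrightarrow> {u, v} \<in> E"
  "{Inr e, Inr e'} \<in> total_edges E \<longleftrightarrow> e \<in> E \<and> e' \<in> E \<and> e \<noteq> e' \<and> e \<inter> e' \<noteq> {}"
  "{Inl v, Inr e} \<in> total_edges E \<longleftrightarrow> e \<in> E \<and> v \<in> e"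
  "{Inr e, Inl v} \<in> total_edges E \<longleftrightarrow> e \<in> E \<and> v \<in> e"
  unfolding total_edges_def by (auto simp: doubleton_eq_iff insert_commute)

lemma total_edges_mono: "F \<subseteq> E \<Longrightarrow> total_edges F \<subseteq> total_edges E"
  unfolding total_edges_def by (intro Un_mono) (auto; blast)+

text \<open>\<open>Q a y\<close> stands for a clash of colour \<open>a\<close> with the element
  \<open>y\<close>. Each \<open>y\<close> excludes at most one colour, so fewer than
  \<open>card L\<close> colours are lost.\<close>

lemma greedy_choice:
  assumes "finite N" "card N < card (L :: 'a set)"
    and inj: "\<And>y a a'. y \<in> N \<Longrightarrow> a \<in> L \<Longrightarrow> a' \<in> L \<Longrightarrow> Q a y \<Longrightarrow> Q a' y \<Longrightarrow> a = a'"
  shows "\<exists>a\<in>L. \<forall>y\<in>N. \<not> Q a y"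
proof -
  \<comment> \<open>An infinite list would have \<open>card\<close> 0.\<close>
  have fin: "finite L"
    using assms(2) card.infinite by fastforce
  let ?bad = "\<Union>y\<in>N. {a \<in> L. Q a y}"
  have "card ?bad \<le> (\<Sum>y\<in>N. card {a \<in> L. Q a y})"
    using assms(1) by (rule card_UN_le)
  also have "\<dots> \<le> (\<Sum>y\<in>N. 1)"
  proof (rule sum_mono)
    fix y assume "y \<in> N"
    then show "card {a \<in> L. Q a y} \<le> 1"
      using inj fin by (subst One_nat_def, subst card_le_Suc0_iff_eq) auto
  qed
  finally have "card ?bad < card L"
    using assms(2) by simp
  then have "\<not> L \<subseteq> ?bad"
    using card_mono[of ?bad L] assms(1) fin by auto
  then show ?thesis
    by blast
qed

lemma vdegree_Diff:
  assumes "finite E" "e \<in> E" "u \<in> e"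
  shows "vdegree (E - {e}) u + 1 = vdegree E u"
proof -
  have "{f \<in> E. u \<in> f} = insert e {f \<in> E - {e}. u \<in> f}"
    using assms by auto
  then show ?thesis
    using assms(1) unfolding vdegree_def by simp
qed

lemma card_neighbours_le:
  assumes "finite E"
  shows "finite {w. {u, w} \<in> E}" "card {w. {u, w} \<in> E} \<le> vdegree E u"
proof -
  have inj: "inj_on (\<lambda>w. {u, w}) {w. {u, w} \<in> E}"
    by (auto simp: inj_on_def doubleton_eq_iff)
  have sub: "(\<lambda>w. {u, w}) ` {w. {u, w} \<in> E} \<subseteq> {e \<in> E. u \<in> e}"
    by auto
  show "finite {w. {u, w} \<in> E}"
    using finite_imageD[OF finite_subset[OF sub] inj] assms by simp
  show "card {w. {u, w} \<in> E} \<le> vdegree E u"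
    unfolding vdegree_def using card_inj_on_le[OF inj sub] assms by simp
qed

text \<open>Only the fact that a colour at one end of an edge of the total graph forbids at most one
  colour at the other end matters, so group colourings are treated as correspondence colourings
  with conflict relation \<open>R\<close>.\<close>

lemma total_graph_correspondence_coloring:
  fixes E :: "'v set set" and R :: "'v + 'v set \<Rightarrow> 'a \<Rightarrow> 'v + 'v set \<Rightarrow> 'a \<Rightarrow> bool"
  assumes "finite E" "0 < m"
    and edges: "\<And>e. e \<in> E \<Longrightarrow> e \<subseteq> V \<and> card e = 2"
    and lists: "\<And>x. x \<in> total_verts V E \<Longrightarrow> card (L x) = m"
    and sym: "\<And>x a y b. R x a y b \<Longrightarrow> R y b x a"
    and inj: "\<And>x y a a' b. {x, y} \<in> total_edges E \<Longrightarrow> a \<in> L x \<Longrightarrow> a' \<in> L x \<Longrightarrow> b \<in> L y \<Longrightarrow>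
               R x a y b \<Longrightarrow> R x a' y b \<Longrightarrow> a = a'"
    and light: "\<And>E'. E' \<subseteq> E \<Longrightarrow> E' \<noteq> {} \<Longrightarrow> \<exists>u v. {u, v} \<in> E' \<and> u \<noteq> v \<and> 2 * vdegree E' u < m \<and>
               vdegree E' u + vdegree E' v \<le> m"
  shows "\<exists>c. (\<forall>x\<in>total_verts V E. c x \<in> L x) \<and>
             (\<forall>x y. {x, y} \<in> total_edges E \<longrightarrow> \<not> R x (c x) y (c y))"
proof -
  have "\<exists>c. (\<forall>x\<in>total_verts V F. c x \<in> L x) \<and>
             (\<forall>x y. {x, y} \<in> total_edges F \<longrightarrow> \<not> R x (c x) y (c y))" if "F \<subseteq> E" for F
    using finite_subset[OF that \<open>finite E\<close>] that
  proof (induction F rule: finite_psubset_induct)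
    case (psubset F)
    show ?case
    proof (cases "F = {}")
      case True
      have "\<forall>x\<in>total_verts V F. \<exists>a. a \<in> L x"
      proof
        fix x assume "x \<in> total_verts V F"
        then have "card (L x) = m"
          using lists psubset.prems by (auto simp: total_verts_def)
        then show "\<exists>a. a \<in> L x"
          using \<open>0 < m\<close> by (metis card.empty ex_in_conv less_irrefl)
      qed
      then obtain c where "\<forall>x\<in>total_verts V F. c x \<in> L x"
        by metis
      then show ?thesis
        using True by (auto simp: total_edges_def)
    next
      case False
      obtain u v where uv: "{u, v} \<in> F" "u \<noteq> v" "2 * vdegree F u < m" "vdegree F u + vdegree F v \<le> m"
        using light[OF psubset.prems False] by blast
      define e where "e = {u, v}"
      define F' where "F' = F - {e}"
      have eF: "e \<in> F" and ue: "u \<in> e" and ve: "v \<in> e" and F': "F' \<subset> F"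
        using uv by (auto simp: e_def F'_def)
      have inE: "z \<in> total_edges E" if "z \<in> total_edges F" for z
        using that total_edges_mono[OF psubset.prems] by blast
      have ends: "x \<in> total_verts V F" if "{x, y} \<in> total_edges F" for x y
        using that edges psubset.prems
        by (cases x; cases y) (fastforce simp: total_edges_iff total_verts_def)+
      obtain c where c: "\<And>x. x \<in> total_verts V F' \<Longrightarrow> c x \<in> L x"
        "\<And>x y. {x, y} \<in> total_edges F' \<Longrightarrow> \<not> R x (c x) y (c y)"
        using psubset.IH[OF F'] F' psubset.prems by blast
      \<comment> \<open>The coloured elements that \<open>e\<close> must respect. The vertex
        \<open>u\<close> is left out because its colour is about to be discarded; this leaves
        \<open>v\<close> and the \<open>d(u) - 1\<close> and \<open>d(v) - 1\<close> further edges
        at the two ends, fewer than \<open>m\<close> elements.\<close>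
      define Ne where "Ne = insert (Inl v) (Inr ` {f \<in> F'. u \<in> f \<or> v \<in> f} :: ('v + 'v set) set)"
      have finF': "finite F'"
        using psubset.hyps by (simp add: F'_def)
      have "card Ne \<le> Suc (card {f \<in> F'. u \<in> f \<or> v \<in> f})"
        using finF' by (simp add: Ne_def card_insert_if card_image)
      also have "{f \<in> F'. u \<in> f \<or> v \<in> f} = {f \<in> F'. u \<in> f} \<union> {f \<in> F'. v \<in> f}"
        by auto
      also have "card \<dots> \<le> vdegree F' u + vdegree F' v"
        unfolding vdegree_def by (rule card_Un_le)
      finally have "card Ne < m"
        using vdegree_Diff[OF psubset.hyps eF ue] vdegree_Diff[OF psubset.hyps eF ve] uv(4)
        unfolding F'_def by linarith
      have Le: "card (L (Inr e)) = m"
        using lists eF psubset.prems by (auto simp: total_verts_def)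
      have cL: "c y \<in> L y" if "{x, y} \<in> total_edges F" "y \<noteq> Inr e" for x y
      proof -
        have "y \<in> total_verts V F"
          using ends[of y x] that by (simp add: insert_commute)
        then show ?thesis
          using c(1) that(2) by (auto simp: total_verts_def F'_def)
      qed
      have NeF: "{Inr e, y} \<in> total_edges F \<and> y \<noteq> Inr e" if "y \<in> Ne" for y
        using that eF ve ue F' by (auto simp: Ne_def total_edges_iff F'_def)
      have "\<exists>a\<in>L (Inr e). \<forall>y\<in>Ne. \<not> R (Inr e) a y (c y)"
      proof (rule greedy_choice[of Ne "L (Inr e)" "\<lambda>a y. R (Inr e) a y (c y)"])
        show "finite Ne"
          using finF' by (simp add: Ne_def)
        show "card Ne < card (L (Inr e))"
          using \<open>card Ne < m\<close> Le by simp
        show "a = a'" if "y \<in> Ne" "a \<in> L (Inr e)" "a' \<in> L (Inr e)" "R (Inr e) a y (c y)" "R (Inr e) a' y (c y)"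
          for y a a'
          using inj[of "Inr e" y a a' "c y"] that NeF[of y] cL[of "Inr e" y] inE by blast
      qed
      then obtain a where a: "a \<in> L (Inr e)" "\<And>y. y \<in> Ne \<Longrightarrow> \<not> R (Inr e) a y (c y)"
        by blast
      define c1 where "c1 = c(Inr e := a)"
      \<comment> \<open>All neighbours of \<open>u\<close> in the total graph, the freshly coloured
        \<open>e\<close> among them: at most \<open>d(u)\<close> vertices and exactly
        \<open>d(u)\<close> edges.\<close>
      define Nu where "Nu = (Inl ` {w. {u, w} \<in> F} \<union> Inr ` {f \<in> F. u \<in> f} :: ('v + 'v set) set)"
      have "card Nu \<le> card (Inl ` {w. {u, w} \<in> F} :: ('v + 'v set) set) + card (Inr ` {f \<in> F. u \<in> f} :: ('v + 'v set) set)"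
        unfolding Nu_def by (rule card_Un_le)
      also have "\<dots> \<le> vdegree F u + vdegree F u"
        using card_neighbours_le[OF psubset.hyps, of u]
        by (simp add: card_image vdegree_def)
      finally have Nu: "card Nu < m"
        using uv(3) by simp
      have Lu: "card (L (Inl u)) = m"
        using lists eF ue edges psubset.prems by (auto simp: total_verts_def)
      have c1L: "c1 y \<in> L y" if "{x, y} \<in> total_edges F" for x y
        using cL[OF that] a(1) by (auto simp: c1_def)
      have NuF: "{Inl u, y} \<in> total_edges F" if "y \<in> Nu" for y
        using that by (auto simp: Nu_def total_edges_iff)
      have "\<exists>b\<in>L (Inl u). \<forall>y\<in>Nu. \<not> R (Inl u) b y (c1 y)"
      proof (rule greedy_choice[of Nu "L (Inl u)" "\<lambda>a y. R (Inl u) a y (c1 y)"])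
        show "finite Nu"
          using psubset.hyps card_neighbours_le(1)[OF psubset.hyps] by (simp add: Nu_def)
        show "card Nu < card (L (Inl u))"
          using Nu Lu by simp
        show "a = a'" if "y \<in> Nu" "a \<in> L (Inl u)" "a' \<in> L (Inl u)" "R (Inl u) a y (c1 y)" "R (Inl u) a' y (c1 y)"
          for y a a'
          using inj[of "Inl u" y a a' "c1 y"] that NuF[of y] c1L[of "Inl u" y] inE by blast
      qed
      then obtain b where b: "b \<in> L (Inl u)" "\<And>y. y \<in> Nu \<Longrightarrow> \<not> R (Inl u) b y (c1 y)"
        by blast
      define c2 where "c2 = c1(Inl u := b)"
      have nbr_u: "y \<in> Nu \<and> y \<noteq> Inl u" if "{Inl u, y} \<in> total_edges F" for y
      proof -
        have "{u} \<notin> F"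
          using edges[of "{u}"] psubset.prems by auto
        then show ?thesis
          using that by (cases y) (auto simp: total_edges_iff Nu_def)
      qed
      have nbr_e: "y \<in> Ne \<and> y \<noteq> Inr e" if "{Inr e, y} \<in> total_edges F" "y \<noteq> Inl u" for y
        using that uv(2) by (cases y) (auto simp: total_edges_iff Ne_def F'_def e_def)
      have c2: "\<not> R x (c2 x) y (c2 y)" if xy: "{x, y} \<in> total_edges F" for x y
      proof -
        have u: "\<not> R (Inl u) (c2 (Inl u)) y (c2 y)" if "{Inl u, y} \<in> total_edges F" for y
          using nbr_u[OF that] b(2) by (auto simp: c2_def)
        have e: "\<not> R (Inr e) (c2 (Inr e)) y (c2 y)" if "{Inr e, y} \<in> total_edges F" "y \<noteq> Inl u" for y
          using nbr_e[OF that] a(2) that(2) by (auto simp: c2_def c1_def)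
        have yx: "{y, x} \<in> total_edges F"
          using xy by (simp add: insert_commute)
        consider "x = Inl u" | "y = Inl u" | "x \<noteq> Inl u" "y \<noteq> Inl u" "x = Inr e"
          | "x \<noteq> Inl u" "y \<noteq> Inl u" "y = Inr e" | "x \<noteq> Inl u" "y \<noteq> Inl u" "x \<noteq> Inr e" "y \<noteq> Inr e"
          by blast
        then show ?thesis
        proof cases
          \<comment> \<open>A pair avoiding both \<open>u\<close> and \<open>e\<close> keeps its old
            colours and was already adjacent before \<open>e\<close> was put back.\<close>
          case 5
          then have "{x, y} \<in> total_edges F'"
            using xy by (cases x; cases y) (auto simp: total_edges_iff F'_def e_def doubleton_eq_iff)
          then show ?thesis
            using c(2)[of x y] 5 by (simp add: c2_def c1_def)
        qed (use u e xy yx sym in \<open>metis\<close>)+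
      qed
      have "c2 x \<in> L x" if "x \<in> total_verts V F" for x
        using that c(1)[of x] a(1) b(1)
        by (auto simp: c2_def c1_def total_verts_def F'_def)
      then show ?thesis
        using c2 by blast
    qed
  qed
  then show ?thesis
    by blast
qed

lemma total_group_choosable:
  fixes V :: "'v set" and E :: "'v set set"
  assumes "simple_graph V E" "0 < m"
    and light: "\<And>E'. E' \<subseteq> E \<Longrightarrow> E' \<noteq> {} \<Longrightarrow> \<exists>u v. {u, v} \<in> E' \<and> u \<noteq> v \<and> 2 * vdegree E' u < m \<and>
               vdegree E' u + vdegree E' v \<le> m"
  shows "group_choosable TYPE('a) m (total_verts V E) (total_edges E)"
  unfolding group_choosable_def
proof (intro allI impI, elim conjE)
  fix A :: "'a monoid" and D L f
  assume "group A" and D: "orientation (total_edges E) D"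
    and L: "\<forall>v\<in>total_verts V E. L v \<subseteq> carrier A \<and> finite (L v) \<and> card (L v) = m"
    and f: "\<forall>e\<in>total_edges E. f e \<in> carrier A"
  interpret group A by fact
  \<comment> \<open>A conflict is read off from whichever of the two arcs belongs to
    \<open>D\<close>. This makes \<open>R\<close> symmetric and removes the orientation from the
    colouring argument.\<close>
  define R where "R x a y b \<longleftrightarrow> (x, y) \<in> D \<and> a \<otimes>\<^bsub>A\<^esub> inv\<^bsub>A\<^esub> b = f {x, y} \<or>
      (y, x) \<in> D \<and> b \<otimes>\<^bsub>A\<^esub> inv\<^bsub>A\<^esub> a = f {x, y}" for x a y b
  have edges: "e \<subseteq> V \<and> card e = 2" if "e \<in> E" for e
    using assms(1) that by (auto simp: simple_graph_def)
  have "finite E"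
    using assms(1) edges by (meson PowI finite_Pow_iff finite_subset simple_graph_def subsetI)
  have loopless: "x \<noteq> y" if "{x, y} \<in> total_edges E" for x y
  proof (cases x; cases y)
    fix u v assume "x = Inl u" "y = Inl v"
    then show ?thesis
      using that edges[of "{u, v}"] by (auto simp: total_edges_iff)
  qed (use that in \<open>auto simp: total_edges_iff\<close>)
  have ends: "x \<in> total_verts V E" if "{x, y} \<in> total_edges E" for x y
    using that edges
    by (cases x; cases y) (fastforce simp: total_edges_iff total_verts_def)+
  have inj_D: "inj_on (\<lambda>(x, y). {x, y}) D" and img_D: "(\<lambda>(x, y). {x, y}) ` D = total_edges E"
    using D by (auto simp: orientation_def bij_betw_def)
  have "\<exists>c. (\<forall>x\<in>total_verts V E. c x \<in> L x) \<and>
             (\<forall>x y. {x, y} \<in> total_edges E \<longrightarrow> \<not> R x (c x) y (c y))"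
  proof (rule total_graph_correspondence_coloring[where m = m])
    show "R y b x a" if "R x a y b" for x a y b
      using that by (auto simp: R_def insert_commute)
    show "a = a'" if xy: "{x, y} \<in> total_edges E" and "a \<in> L x" "a' \<in> L x" "b \<in> L y"
      and R: "R x a y b" "R x a' y b" for x y a a' b
    proof -
      have "y \<in> total_verts V E"
        using ends[of y x] xy by (simp add: insert_commute)
      then have carr: "a \<in> carrier A" "a' \<in> carrier A" "b \<in> carrier A"
        using that L ends[OF xy] by auto
      \<comment> \<open>Both conflicts therefore come from the same arc, and cancellation on the
        right or on the left gives \<open>a = a'\<close> without commutativity.\<close>
      have "\<not> ((x, y) \<in> D \<and> (y, x) \<in> D)"
        using inj_onD[OF inj_D, of "(x, y)" "(y, x)"] loopless[OF xy] by (auto simp: insert_commute)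
      then have "a \<otimes>\<^bsub>A\<^esub> inv\<^bsub>A\<^esub> b = a' \<otimes>\<^bsub>A\<^esub> inv\<^bsub>A\<^esub> b \<or> b \<otimes>\<^bsub>A\<^esub> inv\<^bsub>A\<^esub> a = b \<otimes>\<^bsub>A\<^esub> inv\<^bsub>A\<^esub> a'"
        using R unfolding R_def by auto
      then show ?thesis
        using carr by (metis Units_eq Units_l_cancel inv_closed inv_inv right_cancel)
    qed
  qed (use assms edges L \<open>finite E\<close> in auto)
  then obtain c where c: "\<forall>x\<in>total_verts V E. c x \<in> L x"
    "\<And>x y. {x, y} \<in> total_edges E \<Longrightarrow> \<not> R x (c x) y (c y)"
    by blast
  have "c x \<otimes>\<^bsub>A\<^esub> inv\<^bsub>A\<^esub> c y \<noteq> f {x, y}" if "(x, y) \<in> D" for x y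
  proof -
    have "{x, y} \<in> total_edges E"
      using that img_D by force
    then show ?thesis
      using c(2)[of x y] that by (auto simp: R_def)
  qed
  then show "\<exists>c. group_coloring A L f (total_verts V E) D c"
    using c(1) by (auto simp: group_coloring_def)
qed

section \<open>Theta curves\<close>

lemma arc_has_inner_point:
  assumes "arc c"
  shows "\<not> path_image c \<subseteq> {pathstart c, pathfinish c}"
proof -
  have "c (1/2) \<noteq> c 0" "c (1/2) \<noteq> c 1"
    using assms by (auto simp: arc_def dest: inj_onD[of _ _ "1/2" 0] inj_onD[of _ _ "1/2" 1])
  moreover have "c (1/2) \<in> path_image c"
    by (auto simp: path_image_def)
  ultimately show ?thesis
    by (auto simp: pathstart_def pathfinish_def)
qed

text \<open>The Jordan curve theorem in the form in which theta curves use it: the closed curve is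
  given by two arcs with common ends, the second one traversed backwards.\<close>

lemma Jordan_two_arcs:
  fixes c1 :: "real \<Rightarrow> complex"
  assumes "arc c1" "pathstart c1 = a" "pathfinish c1 = b"
    and "arc c2" "pathstart c2 = a" "pathfinish c2 = b"
    and "path_image c1 \<inter> path_image c2 = {a, b}"
  defines "J \<equiv> path_image c1 \<union> path_image c2"
  shows "simple_path (c1 +++ reversepath c2)" "path_image (c1 +++ reversepath c2) = J"
    and "inside J \<noteq> {}" "open (inside J)" "connected (inside J)" "outside J \<noteq> {}" "open (outside J)"
        "connected (outside J)" "inside J \<inter> outside J = {}" "inside J \<union> outside J = - J"
        "frontier (inside J) = J" "frontier (outside J) = J"
proof -
  show sp: "simple_path (c1 +++ reversepath c2)"
    using assms by (intro simple_path_join_loop) (auto simp: arc_reversepath)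
  show J: "path_image (c1 +++ reversepath c2) = J"
    using assms by (simp add: path_image_join)
  show "inside J \<noteq> {}" "open (inside J)" "connected (inside J)" "outside J \<noteq> {}" "open (outside J)"
        "connected (outside J)" "inside J \<inter> outside J = {}" "inside J \<union> outside J = - J"
        "frontier (inside J) = J" "frontier (outside J) = J"
    using Jordan_inside_outside[OF sp] assms unfolding J by auto
qed

text \<open>A side of the curve that meets \<open>f\<close> cannot cross the frontier of
  \<open>f\<close>, so it lies in \<open>f\<close>. Being connected and disjoint from the curve,
  \<open>f\<close> meets only one of the two open sides.\<close>

lemma Jordan_complementary_domain:
  fixes c :: "real \<Rightarrow> complex"
  assumes "simple_path c" "pathfinish c = pathstart c"
    and "open f" "connected f" "f \<noteq> {}" "frontier f = path_image c"
  shows "f = inside (path_image c) \<or> f = outside (path_image c)"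
proof -
  define J where "J = path_image c"
  have J: "connected (inside J)" "connected (outside J)" "open (inside J)" "open (outside J)"
    using Jordan_inside_outside[OF assms(1,2)] by (auto simp: J_def)
  have UJ: "inside J \<union> outside J = - J"
    by simp
  have "f \<inter> J = {}"
    using assms(3,6) by (auto simp: J_def frontier_def interior_open)
  have sub: "g \<subseteq> f" if "connected g" "g \<inter> J = {}" "g \<inter> f \<noteq> {}" for g
    using connected_Int_frontier[OF that(1), of f] that assms(6) by (auto simp: J_def)
  have cover: "f \<subseteq> inside J \<union> outside J"
    using UJ \<open>f \<inter> J = {}\<close> by blast
  have disj: "inside J \<inter> J = {}" "outside J \<inter> J = {}"
    using inside_no_overlap outside_no_overlap by blast+
  have "inside J \<inter> f = {} \<or> outside J \<inter> f = {}"
    using connectedD[OF assms(4) J(3,4) _ cover] inside_Int_outside[of J] by blast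
  then have "f = inside J \<or> f = outside J"
    using sub[OF J(1) disj(1)] sub[OF J(2) disj(2)] cover assms(5) by blast
  then show ?thesis
    by (simp add: J_def)
qed

text \<open>The three boundary cycles of a theta graph, suitably oriented, have winding numbers adding up
  to zero around every point. If no arc ran inside the cycle formed by the two others, the
  three insides would be disjoint, and around a point of one of them the sum would be 1 or -1.\<close>

lemma theta_some_arc_inside:
  fixes c :: "real \<Rightarrow> complex"
  assumes c1: "arc c1" "pathstart c1 = a" "pathfinish c1 = b"
    and c2: "arc c2" "pathstart c2 = a" "pathfinish c2 = b"
    and c: "arc c" "pathstart c = a" "pathfinish c = b"
    and i12: "path_image c1 \<inter> path_image c2 = {a, b}"
    and i1: "path_image c1 \<inter> path_image c = {a, b}"
    and i2: "path_image c2 \<inter> path_image c = {a, b}"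
  shows "path_image c \<inter> inside (path_image c1 \<union> path_image c2) \<noteq> {} \<or>
         path_image c1 \<inter> inside (path_image c2 \<union> path_image c) \<noteq> {} \<or>
         path_image c2 \<inter> inside (path_image c1 \<union> path_image c) \<noteq> {}"
proof (rule ccontr)
  let ?A1 = "path_image c1" and ?A2 = "path_image c2" and ?A = "path_image c"
  assume "\<not> ?thesis"
  then have neg: "?A \<inter> inside (?A1 \<union> ?A2) = {}" "?A1 \<inter> inside (?A2 \<union> ?A) = {}"
    "?A2 \<inter> inside (?A1 \<union> ?A) = {}"
    by auto
  note J12 = Jordan_two_arcs[OF c1 c2 i12]
  note J2 = Jordan_two_arcs[OF c2 c i2]
  note J1 = Jordan_two_arcs[OF c1 c i1]
  have ne: "\<not> ?A1 \<subseteq> {a, b}" "\<not> ?A2 \<subseteq> {a, b}"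
    using arc_has_inner_point[OF c1(1)] arc_has_inner_point[OF c2(1)] c1 c2 by auto
  have d12: "inside (?A1 \<union> ?A2) \<inter> (?A1 \<union> ?A2) = {}" and d2: "inside (?A2 \<union> ?A) \<inter> (?A2 \<union> ?A) = {}"
    and d1: "inside (?A1 \<union> ?A) \<inter> (?A1 \<union> ?A) = {}"
    by (auto dest: inside_no_overlap[THEN equalityD1, THEN subsetD])
  \<comment> \<open>Neither set can leave the other without crossing its frontier.\<close>
  have same: "U = W" if "connected U" "connected W" "U \<inter> frontier W = {}" "W \<inter> frontier U = {}" "U \<inter> W \<noteq> {}"
    for U W :: "complex set"
  proof -
    have "U - W = {}"
      using connected_Int_frontier[OF that(1), of W] that(3,5) by argo
    moreover have "W - U = {}"
      using connected_Int_frontier[OF that(2), of U] that(4,5) by (simp add: Int_commute) argo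
    ultimately show ?thesis
      by auto
  qed
  have "inside (?A1 \<union> ?A2) \<inter> inside (?A2 \<union> ?A) = {}"
  proof (rule ccontr)
    assume "inside (?A1 \<union> ?A2) \<inter> inside (?A2 \<union> ?A) \<noteq> {}"
    moreover have "inside (?A1 \<union> ?A2) \<inter> (?A2 \<union> ?A) = {}" "inside (?A2 \<union> ?A) \<inter> (?A1 \<union> ?A2) = {}"
      using neg d12 d2 by blast+
    ultimately have "inside (?A1 \<union> ?A2) = inside (?A2 \<union> ?A)"
      using same[OF J12(5) J2(5)] J12(11) J2(11) by metis
    \<comment> \<open>Equal regions have equal frontiers, which would leave no inner point for the
      arc \<open>c1\<close>.\<close>
    then have "?A1 \<union> ?A2 = ?A2 \<union> ?A"
      using J12(11) J2(11) by metis
    then show False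
      using ne i12 i1 by blast
  qed
  moreover have "inside (?A1 \<union> ?A2) \<inter> inside (?A1 \<union> ?A) = {}"
  proof (rule ccontr)
    assume "inside (?A1 \<union> ?A2) \<inter> inside (?A1 \<union> ?A) \<noteq> {}"
    moreover have "inside (?A1 \<union> ?A2) \<inter> (?A1 \<union> ?A) = {}" "inside (?A1 \<union> ?A) \<inter> (?A1 \<union> ?A2) = {}"
      using neg d12 d1 by blast+
    ultimately have "inside (?A1 \<union> ?A2) = inside (?A1 \<union> ?A)"
      using same[OF J12(5) J1(5)] J12(11) J1(11) by metis
    then have "?A1 \<union> ?A2 = ?A1 \<union> ?A"
      using J12(11) J1(11) by metis
    then show False
      using ne i12 i2 by blast
  qed
  moreover obtain z where z: "z \<in> inside (?A1 \<union> ?A2)"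
    using J12(3) by blast
  ultimately have "z \<notin> inside (?A2 \<union> ?A)" "z \<notin> inside (?A1 \<union> ?A)"
    by blast+
  have paths: "path c1" "path c2" "path c"
    using c1 c2 c by (auto simp: arc_imp_path)
  have nz: "z \<notin> ?A1" "z \<notin> ?A2" "z \<notin> ?A"
    using z d12 neg by blast+
  have out: "z \<in> outside (?A2 \<union> ?A)" "z \<in> outside (?A1 \<union> ?A)"
    using \<open>z \<notin> inside (?A2 \<union> ?A)\<close> \<open>z \<notin> inside (?A1 \<union> ?A)\<close> nz
      J2(10)[THEN equalityD2, THEN subsetD, of z] J1(10)[THEN equalityD2, THEN subsetD, of z] by blast+
  have "winding_number (c1 +++ reversepath c2) z = winding_number c1 z - winding_number c2 z"
    "winding_number (c2 +++ reversepath c) z = winding_number c2 z - winding_number c z"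
    "winding_number (c1 +++ reversepath c) z = winding_number c1 z - winding_number c z"
    using nz paths c1 c2 c by (simp_all add: winding_number_join winding_number_reversepath)
  moreover have "winding_number (c2 +++ reversepath c) z = 0" "winding_number (c1 +++ reversepath c) z = 0"
    using out J1(1,2) J2(1,2) c1 c2 c
    by (auto intro!: winding_number_zero_in_outside simp: simple_path_imp_path)
  moreover have "cmod (winding_number (c1 +++ reversepath c2) z) = 1"
    using simple_closed_path_norm_winding_number_inside[OF J12(1), of z] z J12(2) c1 c2 by simp
  ultimately show False
    by simp
qed

text \<open>The first two assumptions are the bounded splitting theorem for the curve
  \<open>A2 \<union> A\<close> with \<open>A1\<close> running inside it. Taking complements tells
  how \<open>A\<close> divides the unbounded side of \<open>A1 \<union> A2\<close>; point by point
  this is propositional logic.\<close>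

lemma outer_faces:
  fixes A1 A2 A :: "complex set"
  assumes "inside (A1 \<union> A2) \<inter> inside (A1 \<union> A) = {}"
    "inside (A1 \<union> A2) \<union> inside (A1 \<union> A) \<union> (A1 - {a, b}) = inside (A2 \<union> A)"
    "inside (A1 \<union> A2) \<inter> outside (A1 \<union> A2) = {}" "inside (A1 \<union> A2) \<union> outside (A1 \<union> A2) = - (A1 \<union> A2)"
    "inside (A1 \<union> A) \<union> outside (A1 \<union> A) = - (A1 \<union> A)"
    "inside (A2 \<union> A) \<inter> outside (A2 \<union> A) = {}" "inside (A2 \<union> A) \<union> outside (A2 \<union> A) = - (A2 \<union> A)"
    "a \<in> A" "b \<in> A"
  shows "inside (A1 \<union> A) \<union> outside (A2 \<union> A) = outside (A1 \<union> A2) - A"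
proof (rule Set.set_eqI)
  fix z
  have inA: "z = a \<or> z = b \<Longrightarrow> z \<in> A"
    using assms(8,9) by blast
  show "z \<in> inside (A1 \<union> A) \<union> outside (A2 \<union> A) \<longleftrightarrow> z \<in> outside (A1 \<union> A2) - A"
    using assms(1-7)[THEN set_eq_iff[THEN iffD1], rule_format, of z] inA
    unfolding Un_iff Int_iff Compl_iff Diff_iff insert_iff empty_iff by argo
qed

text \<open>A bounded \<open>f\<close> is divided by the known theorem on arcs inside a closed
  curve. The unbounded side is reduced to that case by viewing another arc of the theta curve as the
  dividing one.\<close>

lemma crosscut_splits_face:
  fixes c :: "real \<Rightarrow> complex"
  assumes c1: "arc c1" "pathstart c1 = a" "pathfinish c1 = b"
    and c2: "arc c2" "pathstart c2 = a" "pathfinish c2 = b"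
    and c: "arc c" "pathstart c = a" "pathfinish c = b"
    and i12: "path_image c1 \<inter> path_image c2 = {a, b}"
    and f: "open f" "connected f" "f \<noteq> {}" "frontier f = path_image c1 \<union> path_image c2"
    and cf: "path_image c - {a, b} \<subseteq> f"
  obtains f1 f2 where "open f1" "connected f1" "f1 \<noteq> {}" "frontier f1 = path_image c1 \<union> path_image c"
    "open f2" "connected f2" "f2 \<noteq> {}" "frontier f2 = path_image c2 \<union> path_image c"
    "f1 \<inter> f2 = {}" "f1 \<union> f2 = f - path_image c"
proof -
  let ?A1 = "path_image c1" and ?A2 = "path_image c2" and ?A = "path_image c"
  have ends: "a \<in> ?A1" "b \<in> ?A1" "a \<in> ?A2" "b \<in> ?A2" "a \<in> ?A" "b \<in> ?A"
    using c1 c2 c pathstart_in_path_image pathfinish_in_path_image by metis+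
  have ab: "a \<noteq> b"
    using c1 arc_distinct_ends by metis
  have disj: "f \<inter> (?A1 \<union> ?A2) = {}"
    using f(1,4) by (auto simp: frontier_def interior_open)
  have i1: "?A1 \<inter> ?A = {a, b}" and i2: "?A2 \<inter> ?A = {a, b}"
    using cf disj ends by blast+
  note J12 = Jordan_two_arcs[OF c1 c2 i12]
  note J2 = Jordan_two_arcs[OF c2 c i2]
  note J1 = Jordan_two_arcs[OF c1 c i1]
  have fJ: "f = inside (?A1 \<union> ?A2) \<or> f = outside (?A1 \<union> ?A2)"
    using Jordan_complementary_domain[OF J12(1) _ f(1,2,3)] J12(2) f(4) c1 c2 by simp
  note sp = c1(1)[THEN arc_imp_simple_path] c2(1)[THEN arc_imp_simple_path] c(1)[THEN arc_imp_simple_path]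
  have "\<not> ?A \<subseteq> {a, b}"
    using arc_has_inner_point[OF c(1)] c by auto
  from fJ show thesis
  proof
    assume fin: "f = inside (?A1 \<union> ?A2)"
    have "?A \<inter> inside (?A1 \<union> ?A2) \<noteq> {}"
      using cf fin \<open>\<not> ?A \<subseteq> {a, b}\<close> by blast
    from split_inside_simple_closed_curve[OF sp(1) c1(2,3) sp(2) c2(2,3) sp(3) c(2,3) ab i12 i1 i2 this]
    have "inside (?A1 \<union> ?A) \<inter> inside (?A2 \<union> ?A) = {}"
      "inside (?A1 \<union> ?A) \<union> inside (?A2 \<union> ?A) \<union> (?A - {a, b}) = f"
      using fin by auto
    moreover have "inside (?A1 \<union> ?A) \<inter> ?A = {}" "inside (?A2 \<union> ?A) \<inter> ?A = {}"
      using inside_no_overlap[of "?A1 \<union> ?A"] inside_no_overlap[of "?A2 \<union> ?A"] by blast+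
    moreover have "a \<notin> f" "b \<notin> f"
      using disj ends by auto
    ultimately have "inside (?A1 \<union> ?A) \<inter> inside (?A2 \<union> ?A) = {}"
      "inside (?A1 \<union> ?A) \<union> inside (?A2 \<union> ?A) = f - ?A"
      by blast+
    then show thesis
      by (rule that[OF J1(4,5,3,11) J2(4,5,3,11)])
  next
    assume fout: "f = outside (?A1 \<union> ?A2)"
    have "?A \<inter> inside (?A1 \<union> ?A2) = {}"
    proof -
      have "?A \<subseteq> outside (?A1 \<union> ?A2) \<union> (?A1 \<union> ?A2)"
        using cf ends unfolding fout by blast
      then show ?thesis
        using J12(9) inside_no_overlap[of "?A1 \<union> ?A2"] by blast
    qed
    \<comment> \<open>As \<open>c\<close> runs on the unbounded side, the arc lying inside the cycle
      of the other two must be \<open>c1\<close> or \<open>c2\<close>. The bounded theorem then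
      applies to that larger cycle.\<close>
    then have "?A1 \<inter> inside (?A2 \<union> ?A) \<noteq> {} \<or> ?A2 \<inter> inside (?A1 \<union> ?A) \<noteq> {}"
      using theta_some_arc_inside[OF c1 c2 c i12 i1 i2] by argo
    then show thesis
    proof
      assume 1: "?A1 \<inter> inside (?A2 \<union> ?A) \<noteq> {}"
      from split_inside_simple_closed_curve[OF sp(2) c2(2,3) sp(3) c(2,3) sp(1) c1(2,3) ab i2 i12[unfolded Int_commute[of ?A1]] i1[unfolded Int_commute[of ?A1]] 1]
      have *: "inside (?A1 \<union> ?A2) \<inter> inside (?A1 \<union> ?A) = {}"
        "inside (?A1 \<union> ?A2) \<union> inside (?A1 \<union> ?A) \<union> (?A1 - {a, b}) = inside (?A2 \<union> ?A)"
        by (simp_all only: Un_commute)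
      have "inside (?A1 \<union> ?A) \<union> outside (?A2 \<union> ?A) = outside (?A1 \<union> ?A2) - ?A"
        using * J12(9,10) J1(10) J2(9,10) ends(5,6) by (rule outer_faces)
      moreover have "inside (?A1 \<union> ?A) \<inter> outside (?A2 \<union> ?A) = {}"
      proof -
        have "inside (?A1 \<union> ?A) \<subseteq> inside (?A2 \<union> ?A)"
          using *(2) by blast
        then show ?thesis
          using J2(9) by blast
      qed
      ultimately show thesis
        unfolding fout[symmetric] by (intro that[OF J1(4,5,3,11) J2(7,8,6,12)])
    next
      assume 2: "?A2 \<inter> inside (?A1 \<union> ?A) \<noteq> {}"
      from split_inside_simple_closed_curve[OF sp(1) c1(2,3) sp(3) c(2,3) sp(2) c2(2,3) ab i1 i12 i2[unfolded Int_commute[of ?A2]] 2]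
      have *: "inside (?A2 \<union> ?A1) \<inter> inside (?A2 \<union> ?A) = {}"
        "inside (?A2 \<union> ?A1) \<union> inside (?A2 \<union> ?A) \<union> (?A2 - {a, b}) = inside (?A1 \<union> ?A)"
        by (simp_all only: Un_commute)
      have "inside (?A2 \<union> ?A) \<union> outside (?A1 \<union> ?A) = outside (?A2 \<union> ?A1) - ?A"
        using * J12(9,10)[unfolded Un_commute[of ?A1 ?A2]] J2(10) J1(9,10) ends(5,6) by (rule outer_faces)
      moreover have "outside (?A1 \<union> ?A) \<inter> inside (?A2 \<union> ?A) = {}"
      proof -
        have "inside (?A2 \<union> ?A) \<subseteq> inside (?A1 \<union> ?A)"
          using *(2) by blast
        then show ?thesis
          using J1(9) by blast
      qed
      ultimately show thesis
        unfolding Un_commute[of ?A2 ?A1] fout[symmetric] Un_commute[of "inside (?A2 \<union> ?A)"]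
        by (intro that[OF J1(7,8,6,12) J2(4,5,3,11)])
    qed
  qed
qed

section \<open>Boundary cycles of faces\<close>

fun path_edges :: "'v list \<Rightarrow> 'v set set" where
  "path_edges (x # y # zs) = insert {x, y} (path_edges (y # zs))"
| "path_edges _ = {}"

definition cycle_edges :: "'v list \<Rightarrow> 'v set set" where
  "cycle_edges xs = path_edges (xs @ [hd xs])"

lemma path_edges_append: "path_edges (xs @ y # zs) = path_edges (xs @ [y]) \<union> path_edges (y # zs)"
  by (induction xs rule: path_edges.induct) auto

lemma path_edges_snoc: "path_edges (xs @ [y, z]) = insert {y, z} (path_edges (xs @ [y]))"
  using path_edges_append[of xs y "[z]"] by simp

lemma path_edges_rev: "path_edges (rev xs) = path_edges xs"
proof (induction xs rule: path_edges.induct)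
  case (1 x y zs)
  then show ?case
    using path_edges_snoc[of "rev zs" y x] by (simp add: insert_commute)
qed auto

lemma path_edges_subset: "e \<in> path_edges xs \<Longrightarrow> e \<subseteq> set xs"
  by (induction xs rule: path_edges.induct) auto

lemma card_path_edge: "e \<in> path_edges xs \<Longrightarrow> distinct xs \<Longrightarrow> card e = 2"
  by (induction xs rule: path_edges.induct) auto

lemma finite_path_edges [simp]: "finite (path_edges xs)"
  by (induction xs rule: path_edges.induct) auto

lemma finite_cycle_edges [simp]: "finite (cycle_edges xs)"
  by (simp add: cycle_edges_def)

lemma Union_path_edges: "2 \<le> length xs \<Longrightarrow> \<Union> (path_edges xs) = set xs"
proof (induction xs rule: path_edges.induct)
  case (1 x y zs)
  then show ?case
    by (cases zs) auto
qed auto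

lemma card_path_edges: "distinct xs \<Longrightarrow> card (path_edges xs) = length xs - 1"
proof (induction xs rule: path_edges.induct)
  case (1 x y zs)
  then have "{x, y} \<notin> path_edges (y # zs)"
    using path_edges_subset[of "{x, y}" "y # zs"] by auto
  then show ?case
    using 1 by simp
qed auto

lemma path_edges_at_start:
  assumes "distinct (x # xs)" "xs \<noteq> []"
  shows "{e \<in> path_edges (x # xs). x \<in> e} = {{x, hd xs}}"
proof -
  obtain y zs where xs: "xs = y # zs"
    using assms(2) by (cases xs) auto
  have "x \<notin> e" if "e \<in> path_edges xs" for e
    using path_edges_subset[OF that] assms(1) by auto
  then show ?thesis
    unfolding xs by auto
qed

lemma path_edges_at_end:
  assumes "distinct (xs @ [x])" "xs \<noteq> []"
  shows "{e \<in> path_edges (xs @ [x]). x \<in> e} = {{x, last xs}}"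
proof -
  have "distinct (x # rev xs)" "rev xs \<noteq> []"
    using assms by auto
  from path_edges_at_start[OF this] show ?thesis
    using path_edges_rev[of "xs @ [x]"] by (simp add: hd_rev)
qed

text \<open>Serves to cut the boundary of a face at the two vertices \<open>p\<close> and
  \<open>q\<close> where an ear is attached.\<close>

lemma cycle_edges_two_paths:
  "cycle_edges (p # as @ q # bs) = path_edges (p # as @ [q]) \<union> path_edges (q # bs @ [p])"
  using path_edges_append[of "p # as" q "bs @ [p]"] by (simp add: cycle_edges_def)

lemma cycle_edges_rotate: "cycle_edges (xs @ ys) = cycle_edges (ys @ xs)"
proof (cases "xs = [] \<or> ys = []")
  case False
  then obtain x xs' y ys' where "xs = x # xs'" "ys = y # ys'"
    by (meson neq_Nil_conv)
  then show ?thesis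
    using cycle_edges_two_paths[of x xs' y ys'] cycle_edges_two_paths[of y ys' x xs'] by auto
qed auto

lemma cycle_edges_Cons: "xs \<noteq> [] \<Longrightarrow> cycle_edges (x # xs) = insert {x, last xs} (path_edges (x # xs))"
  using path_edges_snoc[of "x # butlast xs" "last xs" x]
  by (cases xs rule: rev_cases) (auto simp: cycle_edges_def insert_commute)

lemma Union_cycle_edges:
  assumes "2 \<le> length xs"
  shows "\<Union> (cycle_edges xs) = set xs"
proof -
  have "2 \<le> length (xs @ [hd xs])" "hd xs \<in> set xs"
    using assms by (cases xs; simp)+
  then show ?thesis
    using Union_path_edges[of "xs @ [hd xs]"] by (simp add: cycle_edges_def insert_absorb)
qed

lemma card_cycle_edges:
  assumes "distinct xs" "3 \<le> length xs"
  shows "card (cycle_edges xs) = length xs"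
proof -
  obtain x y ys where xs: "xs = x # y # ys"
    using assms(2) by (metis Suc_le_length_iff numeral_3_eq_3)
  have "ys \<noteq> []"
    using assms(2) xs by auto
  \<comment> \<open>The only path edge at \<open>x\<close> is the first one, and from length 3 on
    the closing edge differs from it.\<close>
  have "{x, last ys} \<notin> path_edges xs"
  proof
    assume "{x, last ys} \<in> path_edges xs"
    then have "{x, last ys} \<in> {e \<in> path_edges (x # y # ys). x \<in> e}"
      using xs by simp
    then have "{x, last ys} = {x, y}"
      using assms(1) unfolding xs by (subst (asm) path_edges_at_start) auto
    then show False
      using assms(1) last_in_set[OF \<open>ys \<noteq> []\<close>] unfolding xs doubleton_eq_iff by auto
  qed
  then show ?thesis
    using cycle_edges_Cons[of "y # ys" x] card_path_edges[OF assms(1)] xs \<open>ys \<noteq> []\<close> by simp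
qed

lemma cycle_edges_at:
  assumes "distinct xs" "3 \<le> length xs" "v \<in> set xs"
  obtains a b where "a \<noteq> b" "a \<noteq> v" "b \<noteq> v" "a \<in> set xs" "b \<in> set xs"
    "{e \<in> cycle_edges xs. v \<in> e} = {{v, a}, {v, b}}"
proof -
  obtain us ws where xs: "xs = us @ v # ws"
    using assms(3) by (meson split_list)
  define ys where "ys = ws @ us"
  have rot: "cycle_edges xs = cycle_edges (v # ys)"
    using cycle_edges_rotate[of us "v # ws"] xs by (simp add: ys_def)
  have d: "distinct (v # ys)" "set xs = set (v # ys)" "2 \<le> length ys"
    using assms xs by (auto simp: ys_def)
  then obtain a as where ys: "ys = a # as" "as \<noteq> []"
    by (cases ys rule: path_edges.cases) auto
  have "{e \<in> cycle_edges xs. v \<in> e} = insert {v, last ys} {e \<in> path_edges (v # ys). v \<in> e}"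
  proof -
    have "cycle_edges xs = insert {v, last ys} (path_edges (v # ys))"
      using cycle_edges_Cons[of ys v] ys rot by simp
    then show ?thesis
      by auto
  qed
  also have "\<dots> = {{v, a}, {v, last as}}"
  proof -
    have "{e \<in> path_edges (v # ys). v \<in> e} = {{v, a}}"
      using path_edges_at_start[of v ys] d(1) ys by simp
    then show ?thesis
      using ys by (simp add: insert_commute)
  qed
  finally have at: "{e \<in> cycle_edges xs. v \<in> e} = {{v, a}, {v, last as}}" .
  have "last as \<in> set as"
    using ys(2) by simp
  then have "a \<noteq> last as" "a \<noteq> v" "last as \<noteq> v" "a \<in> set xs" "last as \<in> set xs"
    using d(1) unfolding d(2) ys(1) by auto
  then show thesis
    using at by (rule that)
qed

lemma cycle_edges_nth:
  assumes "i < length xs"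
  shows "{xs ! i, xs ! (Suc i mod length xs)} \<in> cycle_edges xs"
proof -
  have *: "{ys ! i, ys ! Suc i} \<in> path_edges ys" if "Suc i < length ys" for ys :: "'a list"
    using that
  proof (induction ys arbitrary: i rule: path_edges.induct)
    case (1 x y zs)
    then show ?case
      by (cases i) auto
  qed auto
  have "xs \<noteq> []"
    using assms by auto
  then show ?thesis
    using *[of "xs @ [hd xs]"] assms
    by (cases "Suc i = length xs") (auto simp: cycle_edges_def nth_append hd_conv_nth)
qed

lemma has_cycle_of_lengthI:
  assumes "distinct xs" "cycle_edges xs \<subseteq> E"
  shows "has_cycle_of_length (length xs) E"
  unfolding has_cycle_of_length_def
proof (intro exI[of _ xs] conjI allI impI)
  show "{xs ! i, xs ! (Suc i mod length xs)} \<in> E" if "i < length xs" for i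
    using cycle_edges_nth[OF that] assms(2) by auto
qed (use assms in simp_all)

text \<open>The faces of a plane drawing of a 2-connected graph with edge set \<open>H\<close>, seen combinatorially:
  \<open>B f\<close> is the boundary cycle of \<open>f\<close>. The last condition says that the faces around a vertex form a
  single cyclic sequence.\<close>

definition face_system :: "'v set set \<Rightarrow> 'f set \<Rightarrow> ('f \<Rightarrow> 'v list) \<Rightarrow> bool" where
  "face_system H F B \<longleftrightarrow>
     finite H \<and> finite F \<and> card F + card (\<Union>H) = card H + 2 \<and>
     (\<forall>f\<in>F. distinct (B f) \<and> 3 \<le> length (B f) \<and> cycle_edges (B f) \<subseteq> H) \<and>
     (\<forall>e\<in>H. card {f \<in> F. e \<in> cycle_edges (B f)} = 2) \<and>
     (\<forall>v S. S \<subseteq> {e \<in> H. v \<in> e} \<and> S \<noteq> {} \<and> S \<noteq> {e \<in> H. v \<in> e} \<longrightarrow>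
        (\<exists>f\<in>F. \<exists>e\<in>cycle_edges (B f). \<exists>e'\<in>cycle_edges (B f). e \<in> S \<and> v \<in> e' \<and> e' \<notin> S))"

lemma face_systemD:
  assumes "face_system H F B"
  shows "finite H" "finite F" "card F + card (\<Union>H) = card H + 2"
    and "f \<in> F \<Longrightarrow> distinct (B f)" "f \<in> F \<Longrightarrow> 3 \<le> length (B f)" "f \<in> F \<Longrightarrow> cycle_edges (B f) \<subseteq> H"
    and "e \<in> H \<Longrightarrow> card {f \<in> F. e \<in> cycle_edges (B f)} = 2"
proof -
  note * = assms[unfolded face_system_def]
  show "finite H" "finite F" "card F + card (\<Union>H) = card H + 2"
    by (rule * [THEN conjunct1] * [THEN conjunct2, THEN conjunct1] * [THEN conjunct2, THEN conjunct2, THEN conjunct1])+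
  have "\<forall>f\<in>F. distinct (B f) \<and> 3 \<le> length (B f) \<and> cycle_edges (B f) \<subseteq> H"
    by (rule * [THEN conjunct2, THEN conjunct2, THEN conjunct2, THEN conjunct1])
  then show "f \<in> F \<Longrightarrow> distinct (B f)" "f \<in> F \<Longrightarrow> 3 \<le> length (B f)" "f \<in> F \<Longrightarrow> cycle_edges (B f) \<subseteq> H"
    by simp_all
  have "\<forall>e\<in>H. card {f \<in> F. e \<in> cycle_edges (B f)} = 2"
    by (rule * [THEN conjunct2, THEN conjunct2, THEN conjunct2, THEN conjunct2, THEN conjunct1])
  then show "e \<in> H \<Longrightarrow> card {f \<in> F. e \<in> cycle_edges (B f)} = 2"
    by simp
qed

lemma face_system_link:
  assumes "face_system H F B" "S \<subseteq> {e \<in> H. v \<in> e}" "S \<noteq> {}" "S \<noteq> {e \<in> H. v \<in> e}"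
  obtains f e e' where "f \<in> F" "e \<in> cycle_edges (B f)" "e' \<in> cycle_edges (B f)" "e \<in> S" "v \<in> e'" "e' \<notin> S"
proof -
  note * = assms(1)[unfolded face_system_def, THEN conjunct2, THEN conjunct2, THEN conjunct2, THEN conjunct2, THEN conjunct2]
  from * [rule_format, OF conjI[OF assms(2) conjI[OF assms(3,4)]]] show thesis
    using that by (elim bexE conjE)
qed

text \<open>The two labels will be the sides of a Jordan curve. Euler's formula reads
  \<open>2 + n = n + 2\<close>, and the edges at a vertex are linked at once because either face
  contains all of them.\<close>

lemma face_system_cycle:
  assumes "distinct xs" "3 \<le> length xs" "f1 \<noteq> f2"
  shows "face_system (cycle_edges xs) {f1, f2} (\<lambda>_. xs)"
  unfolding face_system_def
proof (intro conjI ballI allI impI)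
  show "card {f1, f2} + card (\<Union> (cycle_edges xs)) = card (cycle_edges xs) + 2"
    using assms by (simp add: card_cycle_edges Union_cycle_edges distinct_card)
  fix e assume "e \<in> cycle_edges xs"
  then have "{f \<in> {f1, f2}. e \<in> cycle_edges xs} = {f1, f2}"
    by auto
  then show "card {f \<in> {f1, f2}. e \<in> cycle_edges xs} = 2"
    using assms by simp
next
  fix v S
  assume "S \<subseteq> {e \<in> cycle_edges xs. v \<in> e} \<and> S \<noteq> {} \<and> S \<noteq> {e \<in> cycle_edges xs. v \<in> e}"
  then show "\<exists>f\<in>{f1, f2}. \<exists>e\<in>cycle_edges xs. \<exists>e'\<in>cycle_edges xs. e \<in> S \<and> v \<in> e' \<and> e' \<notin> S"
    by blast
qed (use assms in auto)

text \<open>The face \<open>f\<close> gives way to two faces, each bounded by the ear and one of the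
  two boundary paths of \<open>f\<close> between \<open>p\<close> and \<open>q\<close>; the first
  path is run backwards, hence \<open>rev as\<close>. Euler's formula persists: one more face,
  \<open>length ps\<close> more vertices, \<open>length ps + 1\<close> more edges. The new labels
  only have to avoid the remaining faces.\<close>

lemma face_system_ear:
  assumes fs: "face_system H F B" and "f \<in> F"
    and Bf: "distinct (p # as @ q # bs)" "cycle_edges (B f) = cycle_edges (p # as @ q # bs)"
    and ps: "distinct ps" "set ps \<inter> \<Union>H = {}" "path_edges (p # ps @ [q]) \<inter> H = {}"
    and new: "f1 \<noteq> f2" "f1 \<notin> F - {f}" "f2 \<notin> F - {f}"
  shows "face_system (H \<union> path_edges (p # ps @ [q])) (insert f1 (insert f2 (F - {f})))
           (B(f1 := p # ps @ q # rev as, f2 := p # ps @ q # bs))"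
    (is "face_system (H \<union> ?P) ?F ?B")
proof -
  note D = face_systemD[OF fs]
  let ?C1 = "path_edges (p # as @ [q])" and ?C2 = "path_edges (q # bs @ [p])"
  have C: "cycle_edges (B f) = ?C1 \<union> ?C2"
    using Bf(2) cycle_edges_two_paths by metis
  have "path_edges (q # rev as @ [p]) = ?C1"
    using path_edges_rev[of "p # as @ [q]"] by simp
  then have cyc1: "cycle_edges (p # ps @ q # rev as) = ?P \<union> ?C1"
    and cyc2: "cycle_edges (p # ps @ q # bs) = ?P \<union> ?C2"
    using cycle_edges_two_paths[of p ps q "rev as"] cycle_edges_two_paths[of p ps q bs] by auto
  have CH: "?C1 \<subseteq> H" "?C2 \<subseteq> H"
    using C D(6)[OF \<open>f \<in> F\<close>] by auto
  \<comment> \<open>The cycle has as many edges as its two parts together, which forces the parts to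
    be edge-disjoint.\<close>
  have "card (cycle_edges (B f)) = 2 + length as + length bs"
  proof -
    have "2 \<le> length (p # as @ q # bs)"
      by simp
    from Union_cycle_edges[OF this] have "set (B f) = set (p # as @ q # bs)"
      using Bf Union_cycle_edges[of "B f"] D(5)[OF \<open>f \<in> F\<close>] by simp
    then have "length (B f) = 2 + length as + length bs"
      using distinct_card[OF D(4)[OF \<open>f \<in> F\<close>]] distinct_card[OF Bf(1)] by simp
    then show ?thesis
      using card_cycle_edges[OF D(4,5)[OF \<open>f \<in> F\<close>]] by simp
  qed
  moreover have "card ?C1 = 1 + length as" "card ?C2 = 1 + length bs"
    using card_path_edges[of "p # as @ [q]"] card_path_edges[of "q # bs @ [p]"] Bf(1) by auto
  ultimately have "card ?C1 + card ?C2 = card (?C1 \<union> ?C2) "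
    using C by simp
  then have disj: "?C1 \<inter> ?C2 = {}"
    using card_Un_Int[of ?C1 ?C2] by simp
  have verts: "set (p # as @ q # bs) \<subseteq> \<Union>H"
    using CH Union_path_edges[of "p # as @ [q]"] Union_path_edges[of "q # bs @ [p]"] by fastforce
  have dP: "distinct (p # ps @ [q])"
    using ps(1,2) Bf(1) verts by auto
  have dC: "distinct (p # as @ [q])" "distinct (q # bs @ [p])"
    using Bf(1) by auto
  \<comment> \<open>If the ear is a single edge, it is new, so neither boundary path is the edge
    \<open>{p, q}\<close>. This keeps both new cycles at length 3 or more.\<close>
  have long: "ps \<noteq> [] \<or> as \<noteq> [] \<and> bs \<noteq> []"
    using ps(3) CH by (auto simp: insert_commute)
  have cycles: "distinct (?B g) \<and> 3 \<le> length (?B g) \<and> cycle_edges (?B g) \<subseteq> H \<union> ?P" if g: "g \<in> ?F" for g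
  proof -
    consider "g = f1" | "g = f2" | "g \<in> F - {f}" "g \<noteq> f1" "g \<noteq> f2"
      using g by blast
    then show ?thesis
    proof cases
      case 1
      then show ?thesis
        using new(1) cyc1 CH dP Bf(1) ps(2) verts long
        by (auto simp: Suc_le_eq numeral_3_eq_3 simp flip: length_greater_0_conv)
    next
      case 2
      then show ?thesis
        using new(1) cyc2 CH dP Bf(1) ps(2) verts long
        by (auto simp: Suc_le_eq numeral_3_eq_3 simp flip: length_greater_0_conv)
    next
      case 3
      then show ?thesis
        using D(4-6)[of g] by auto
    qed
  qed
  have cycF: "cycle_edges (?B g) = (if g = f1 then ?P \<union> ?C1 else if g = f2 then ?P \<union> ?C2 else cycle_edges (B g))" for g
    using cyc1 cyc2 new(1) by simp
  have twice: "card {g \<in> ?F. e \<in> cycle_edges (?B g)} = 2" if "e \<in> H \<union> ?P" for e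
  proof (cases "e \<in> ?P")
    case True
    then have "e \<notin> H"
      using ps(3) by auto
    then have "{g \<in> ?F. e \<in> cycle_edges (?B g)} = {f1, f2}"
      using True D(6) unfolding cycF by (auto split: if_splits)
    then show ?thesis
      using new(1) by simp
  next
    case False
    then have "e \<in> H"
      using that by simp
    define Fe where "Fe = {g \<in> F. e \<in> cycle_edges (B g)}"
    have Fe: "finite Fe" "card Fe = 2"
      using D(2) D(7)[OF \<open>e \<in> H\<close>] by (auto simp: Fe_def)
    consider "e \<in> ?C1" "e \<notin> ?C2" | "e \<in> ?C2" "e \<notin> ?C1" | "e \<notin> ?C1" "e \<notin> ?C2"
      using disj by blast
    then show ?thesis
    proof cases
      case 1
      then have "{g \<in> ?F. e \<in> cycle_edges (?B g)} = insert f1 (Fe - {f})"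
        using False new unfolding cycF Fe_def by (auto split: if_splits)
      moreover have "f \<in> Fe" "f1 \<notin> Fe - {f}"
        using 1 C \<open>f \<in> F\<close> new by (auto simp: Fe_def)
      ultimately show ?thesis
        using Fe by simp
    next
      case 2
      then have "{g \<in> ?F. e \<in> cycle_edges (?B g)} = insert f2 (Fe - {f})"
        using False new unfolding cycF Fe_def by (auto split: if_splits)
      moreover have "f \<in> Fe" "f2 \<notin> Fe - {f}"
        using 2 C \<open>f \<in> F\<close> new by (auto simp: Fe_def)
      ultimately show ?thesis
        using Fe by simp
    next
      case 3
      then have "{g \<in> ?F. e \<in> cycle_edges (?B g)} = Fe"
        using False new C unfolding cycF Fe_def by (auto split: if_splits)
      then show ?thesis
        using Fe by simp
    qed
  qed
  have count: "card ?F + card (\<Union> (H \<union> ?P)) = card (H \<union> ?P) + 2"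
  proof -
    have "card ?F = card F + 1"
      using D(2) \<open>f \<in> F\<close> new by (simp add: card_gt_0_iff card_Diff_singleton_if)
         (metis Suc_pred card_gt_0_iff empty_iff)
    moreover have "\<Union> (H \<union> ?P) = \<Union>H \<union> set ps"
      using Union_path_edges[of "p # ps @ [q]"] verts by auto
    moreover have "finite (\<Union>H)"
    proof -
      have "finite e" if e: "e \<in> H" for e
      proof -
        have "{g \<in> F. e \<in> cycle_edges (B g)} \<noteq> {}"
          using D(7)[OF e] by (metis card.empty zero_neq_numeral)
        then obtain g where "g \<in> F" "e \<in> cycle_edges (B g)"
          by blast
        then show ?thesis
          using path_edges_subset[of e] by (metis cycle_edges_def finite_set finite_subset)
      qed
      then show ?thesis
        using D(1) by blast
    qed
    moreover have "card (\<Union>H \<union> set ps) = card (\<Union>H) + length ps"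
      using \<open>finite (\<Union>H)\<close> ps(1,2) by (simp add: card_Un_disjoint distinct_card Int_commute)
    moreover have "card (H \<union> ?P) = card H + (length ps + 1)"
      using D(1) ps(3) card_path_edges[OF dP] by (subst card_Un_disjoint) (auto simp: Int_commute)
    ultimately show ?thesis
      using D(3) by simp
  qed
  have link: "\<exists>g\<in>?F. \<exists>e\<in>cycle_edges (?B g). \<exists>e'\<in>cycle_edges (?B g). e \<in> S \<and> v \<in> e' \<and> e' \<notin> S"
    if S: "S \<subseteq> {e \<in> H \<union> ?P. v \<in> e}" "S \<noteq> {}" "S \<noteq> {e \<in> H \<union> ?P. v \<in> e}" for v S
  proof -
    have via1: ?thesis if "e \<in> ?P \<union> ?C1" "e' \<in> ?P \<union> ?C1" "e \<in> S" "v \<in> e'" "e' \<notin> S" for e e'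
      using that cycF[of f1] by (intro bexI[of _ f1] bexI[of _ e] bexI[of _ e']) auto
    have via2: ?thesis if "e \<in> ?P \<union> ?C2" "e' \<in> ?P \<union> ?C2" "e \<in> S" "v \<in> e'" "e' \<notin> S" for e e'
      using that cycF[of f2] new(1) by (intro bexI[of _ f2] bexI[of _ e] bexI[of _ e']) auto
    have via_old: ?thesis if "g \<in> F" "g \<noteq> f" "e \<in> cycle_edges (B g)" "e' \<in> cycle_edges (B g)" "e \<in> S" "v \<in> e'" "e' \<notin> S"
      for g e e'
      using that cycF[of g] new by (intro bexI[of _ g] bexI[of _ e] bexI[of _ e']) auto
    obtain e0 e1 where e01: "e0 \<in> S" "e1 \<in> H \<union> ?P" "v \<in> e1" "e1 \<notin> S"
      using S by blast
    consider "v \<in> set ps" | "v \<notin> set ps" "v \<noteq> p" "v \<noteq> q" | "v = p \<or> v = q"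
      by blast
    then show ?thesis
    proof cases
      case 1
      then have "{e \<in> H \<union> ?P. v \<in> e} \<subseteq> ?P"
        using ps(2) by auto
      then show ?thesis
        using via1[of e0 e1] e01 S by blast
    next
      case 2
      then have "v \<notin> \<Union> ?P"
        using Union_path_edges[of "p # ps @ [q]"] by simp
      then have "{e \<in> H \<union> ?P. v \<in> e} = {e \<in> H. v \<in> e}"
        by auto
      then have "S \<subseteq> {e \<in> H. v \<in> e}" "S \<noteq> {e \<in> H. v \<in> e}"
        using S(1,3) by simp_all
      from face_system_link[OF fs this(1) S(2) this(2)]
      obtain g e e' where g: "g \<in> F" "e \<in> cycle_edges (B g)" "e' \<in> cycle_edges (B g)" "e \<in> S" "v \<in> e'" "e' \<notin> S" .
      have "v \<in> e"
        using g(4) S by auto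
      \<comment> \<open>Away from \<open>p\<close> and \<open>q\<close> a vertex lies on at most one
        of the two boundary paths. A link through the old face \<open>f\<close> thus survives in
        \<open>f1\<close> or in \<open>f2\<close>.\<close>
      have "v \<notin> \<Union> ?C1 \<or> v \<notin> \<Union> ?C2"
        using Union_path_edges[of "p # as @ [q]"] Union_path_edges[of "q # bs @ [p]"] 2 Bf(1) by auto
      then show ?thesis
        using via_old[of g e e'] via1[of e e'] via2[of e e'] g C \<open>v \<in> e\<close> by blast
    next
      case 3
      \<comment> \<open>At an end of the ear, \<open>f1\<close> links \<open>c\<close> with
        \<open>a\<close> and \<open>f2\<close> links \<open>c\<close> with \<open>b\<close>. If
        \<open>S\<close> separates neither pair, then \<open>S - {c}\<close> is still a proper
        nonempty set of old edges. The old face linking it to its complement is not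
        \<open>f\<close>, whose only edges at \<open>v\<close> are \<open>a\<close> and
        \<open>b\<close>.\<close>
      have "\<exists>a b c. {e \<in> ?C1. v \<in> e} = {a} \<and> {e \<in> ?C2. v \<in> e} = {b} \<and> {e \<in> ?P. v \<in> e} = {c}"
      proof (cases "v = p")
        case True
        have "{e \<in> ?C1. v \<in> e} = {{p, hd (as @ [q])}}" "{e \<in> ?C2. v \<in> e} = {{p, last (q # bs)}}"
          "{e \<in> ?P. v \<in> e} = {{p, hd (ps @ [q])}}"
          using True path_edges_at_start[of p "as @ [q]"] path_edges_at_end[of "q # bs" p] path_edges_at_start[of p "ps @ [q]"]
            dP dC by simp_all
        then show ?thesis
          by (intro exI conjI)
      next
        case False
        then have "v = q"
          using 3 by simp
        have "{e \<in> ?C1. v \<in> e} = {{q, last (p # as)}}" "{e \<in> ?C2. v \<in> e} = {{q, hd (bs @ [p])}}"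
          "{e \<in> ?P. v \<in> e} = {{q, last (p # ps)}}"
          using \<open>v = q\<close> path_edges_at_end[of "p # as" q] path_edges_at_start[of q "bs @ [p]"] path_edges_at_end[of "p # ps" q]
            dP dC by simp_all
        then show ?thesis
          by (intro exI conjI)
      qed
      then obtain a b c where abc: "{e \<in> ?C1. v \<in> e} = {a}" "{e \<in> ?C2. v \<in> e} = {b}" "{e \<in> ?P. v \<in> e} = {c}"
        by (elim exE conjE)
      have "a \<in> {e \<in> ?C1. v \<in> e}" "b \<in> {e \<in> ?C2. v \<in> e}" "c \<in> {e \<in> ?P. v \<in> e}"
        unfolding abc by simp_all
      then have inc: "a \<in> ?C1" "v \<in> a" "b \<in> ?C2" "v \<in> b" "c \<in> ?P" "v \<in> c"
        by simp_all
      show ?thesis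
      proof (cases "(a \<in> S \<longleftrightarrow> c \<in> S) \<and> (b \<in> S \<longleftrightarrow> c \<in> S)")
        case False
        then consider "a \<in> S" "c \<notin> S" | "c \<in> S" "a \<notin> S" | "b \<in> S" "c \<notin> S" | "c \<in> S" "b \<notin> S"
          by argo
        then show ?thesis
          using via1[of a c] via1[of c a] via2[of b c] via2[of c b] inc by cases simp_all
      next
        case True
        have "c \<notin> H"
          using inc(5) ps(3) by auto
        have "a \<in> H"
          using inc(1) CH by auto
        have onlyc: "e = c" if "e \<in> ?P" "v \<in> e" for e
        proof -
          have "e \<in> {e \<in> ?P. v \<in> e}"
            using that by simp
          then show ?thesis
            unfolding abc by simp
        qed
        have s1: "S - {c} \<subseteq> {e \<in> H. v \<in> e}"
          using S(1) onlyc by auto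
        have s2: "S - {c} \<noteq> {}"
        proof
          assume "S - {c} = {}"
          then have "c \<in> S" "a \<notin> S - {c}"
            using S(2) by auto
          then show False
            using True \<open>a \<in> H\<close> \<open>c \<notin> H\<close> by auto
        qed
        have s3: "S - {c} \<noteq> {e \<in> H. v \<in> e}"
        proof
          assume *: "S - {c} = {e \<in> H. v \<in> e}"
          then have "a \<in> S"
            using \<open>a \<in> H\<close> inc(2) by auto
          then have "c \<in> S"
            using True by simp
          then have "S = insert c {e \<in> H. v \<in> e}"
            unfolding *[symmetric] by (simp add: insert_absorb)
          also have "\<dots> = {e \<in> H \<union> ?P. v \<in> e}"
          proof
            show "insert c {e \<in> H. v \<in> e} \<subseteq> {e \<in> H \<union> ?P. v \<in> e}"
              using inc(5,6) by auto
            show "{e \<in> H \<union> ?P. v \<in> e} \<subseteq> insert c {e \<in> H. v \<in> e}"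
              using onlyc by auto
          qed
          finally have "S = {e \<in> H \<union> ?P. v \<in> e}" .
          then show False
            using S(3) by simp
        qed
        obtain g e e' where g: "g \<in> F" "e \<in> cycle_edges (B g)" "e' \<in> cycle_edges (B g)"
            "e \<in> S - {c}" "v \<in> e'" "e' \<notin> S - {c}"
          by (rule face_system_link[OF fs s1 s2 s3])
        have "e' \<noteq> c"
          using g(1,3) D(6)[OF g(1)] \<open>c \<notin> H\<close> by auto
        then have "e' \<notin> S"
          using g(6) by simp
        have "g \<noteq> f"
        proof
          assume "g = f"
          have "v \<in> e"
            using g(4) S(1) by auto
          have "x \<in> {a, b}" if "x \<in> cycle_edges (B f)" "v \<in> x" for x
          proof -
            have "x \<in> {e \<in> ?C1. v \<in> e} \<union> {e \<in> ?C2. v \<in> e}"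
              using that unfolding C by simp
            then show ?thesis
              unfolding abc by auto
          qed
          then have "e \<in> {a, b}" "e' \<in> {a, b}"
            using g(2,3,5) \<open>v \<in> e\<close> \<open>g = f\<close> by simp_all
          then show False
            using True g(4) \<open>e' \<notin> S\<close> by auto
        qed
        then show ?thesis
          using via_old[of g e e'] g \<open>e' \<notin> S\<close> by simp
      qed
    qed
  qed
  show ?thesis
    unfolding face_system_def
  proof (intro conjI ballI allI impI)
    show "finite (H \<union> ?P)" "finite ?F"
      using D(1,2) by simp_all
    show "card ?F + card (\<Union> (H \<union> ?P)) = card (H \<union> ?P) + 2"
      by (rule count)
    show "\<exists>g\<in>?F. \<exists>e\<in>cycle_edges (?B g). \<exists>e'\<in>cycle_edges (?B g). e \<in> S \<and> v \<in> e' \<and> e' \<notin> S"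
      if "S \<subseteq> {e \<in> H \<union> ?P. v \<in> e} \<and> S \<noteq> {} \<and> S \<noteq> {e \<in> H \<union> ?P. v \<in> e}" for v S
      using link[of S v] that by argo
    show "distinct (?B g)" "3 \<le> length (?B g)" "cycle_edges (?B g) \<subseteq> H \<union> ?P" if "g \<in> ?F" for g
      by (rule cycles[OF that, THEN conjunct1] cycles[OF that, THEN conjunct2, THEN conjunct1]
            cycles[OF that, THEN conjunct2, THEN conjunct2])+
    show "card {g \<in> ?F. e \<in> cycle_edges (?B g)} = 2" if "e \<in> H \<union> ?P" for e
      using that by (rule twice)
  qed
qed

section \<open>Plane drawings\<close>

locale plane_graph =
  fixes V :: "'v set" and E :: "'v set set" and pos :: "'v \<Rightarrow> complex" and crv :: "'v set \<Rightarrow> real \<Rightarrow> complex"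
  assumes drawing: "plane_drawing V E pos crv" and graph: "simple_graph V E"
begin

definition pic :: "'v set set \<Rightarrow> complex set" where
  "pic H = (\<Union>e\<in>H. path_image (crv e))"

lemma pos_eq_iff: "u \<in> V \<Longrightarrow> v \<in> V \<Longrightarrow> pos u = pos v \<longleftrightarrow> u = v"
  using drawing by (auto simp: plane_drawing_def inj_on_def)

lemma edge_subset: "e \<in> E \<Longrightarrow> e \<subseteq> V"
  using graph by (auto simp: simple_graph_def)

lemma arc_crv: "e \<in> E \<Longrightarrow> arc (crv e)"
  and ends_crv: "e \<in> E \<Longrightarrow> {pathstart (crv e), pathfinish (crv e)} = pos ` e"
  and crv_meets_verts: "e \<in> E \<Longrightarrow> path_image (crv e) \<inter> pos ` V = pos ` e"
  using drawing by (simp_all add: plane_drawing_def)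

lemma crv_Int: "e \<in> E \<Longrightarrow> e' \<in> E \<Longrightarrow> e \<noteq> e' \<Longrightarrow> path_image (crv e) \<inter> path_image (crv e') \<subseteq> pos ` (e \<inter> e')"
  using drawing by (simp add: plane_drawing_def)

lemma pic_Un: "pic (H \<union> H') = pic H \<union> pic H'"
  by (auto simp: pic_def)

lemma pic_Int: "H \<subseteq> E \<Longrightarrow> H' \<subseteq> E \<Longrightarrow> H \<inter> H' = {} \<Longrightarrow> pic H \<inter> pic H' \<subseteq> pos ` (\<Union>H \<inter> \<Union>H')"
proof
  fix z assume H: "H \<subseteq> E" "H' \<subseteq> E" "H \<inter> H' = {}" and "z \<in> pic H \<inter> pic H'"
  then obtain e e' where e: "e \<in> H" "e' \<in> H'" "z \<in> path_image (crv e)" "z \<in> path_image (crv e')"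
    by (auto simp: pic_def)
  then have "z \<in> pos ` (e \<inter> e')"
    using crv_Int[of e e'] H by blast
  then show "z \<in> pos ` (\<Union>H \<inter> \<Union>H')"
    using e(1,2) by auto
qed

lemma pos_in_pic_iff:
  assumes "H \<subseteq> E" "v \<in> V"
  shows "pos v \<in> pic H \<longleftrightarrow> v \<in> \<Union>H"
proof
  assume "pos v \<in> pic H"
  then obtain e where e: "e \<in> H" "pos v \<in> path_image (crv e)"
    by (auto simp: pic_def)
  then have "pos v \<in> pos ` e"
    using crv_meets_verts[of e] assms by auto
  then obtain u where "u \<in> e" "pos v = pos u"
    by auto
  moreover have "u \<in> V"
    using edge_subset[of e] e(1) assms(1) \<open>u \<in> e\<close> by auto
  ultimately have "v \<in> e"
    using pos_eq_iff[OF assms(2)] by simp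
  then show "v \<in> \<Union>H"
    using e(1) by auto
next
  assume "v \<in> \<Union>H"
  then obtain e where e: "e \<in> H" "v \<in> e"
    by auto
  then have "pos v \<in> path_image (crv e)"
    using crv_meets_verts[of e] assms by auto
  then show "pos v \<in> pic H"
    using e(1) by (auto simp: pic_def)
qed

lemma edge_arc:
  assumes "{x, y} \<in> E"
  obtains c where "arc c" "pathstart c = pos x" "pathfinish c = pos y" "path_image c = path_image (crv {x, y})"
proof -
  have "{pathstart (crv {x, y}), pathfinish (crv {x, y})} = {pos x, pos y}"
    using ends_crv[OF assms] by simp
  then consider "pathstart (crv {x, y}) = pos x" "pathfinish (crv {x, y}) = pos y"
    | "pathstart (crv {x, y}) = pos y" "pathfinish (crv {x, y}) = pos x"
    by (auto simp: doubleton_eq_iff)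
  then show thesis
    using that[of "crv {x, y}"] that[of "reversepath (crv {x, y})"] arc_crv[OF assms]
    by cases (simp_all add: arc_reversepath)
qed

lemma path_arc:
  assumes "distinct xs" "2 \<le> length xs" "path_edges xs \<subseteq> E"
  shows "\<exists>c. arc c \<and> pathstart c = pos (hd xs) \<and> pathfinish c = pos (last xs) \<and> path_image c = pic (path_edges xs)"
  using assms
proof (induction xs rule: path_edges.induct)
  case (1 x y zs)
  then have xy: "{x, y} \<in> E"
    by simp
  obtain c where c: "arc c" "pathstart c = pos x" "pathfinish c = pos y" "path_image c = path_image (crv {x, y})"
    using edge_arc[OF xy] by metis
  show ?case
  proof (cases "zs = []")
    case True
    then show ?thesis
      using c by (intro exI[of _ c]) (simp add: pic_def)
  next
    case False
    then have "2 \<le> length (y # zs)"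
      by (cases zs) auto
    then obtain d where d: "arc d" "pathstart d = pos y" "pathfinish d = pos (last (y # zs))"
      "path_image d = pic (path_edges (y # zs))"
      using 1 by auto
    have "{x, y} \<notin> path_edges (y # zs)"
      using path_edges_subset[of "{x, y}" "y # zs"] 1(2) by auto
    then have "pic {{x, y}} \<inter> pic (path_edges (y # zs)) \<subseteq> pos ` (\<Union>{{x, y}} \<inter> \<Union>(path_edges (y # zs)))"
      using 1(4) by (intro pic_Int) auto
    also have "\<dots> \<subseteq> {pos y}"
      using 1(2) Union_path_edges[OF \<open>2 \<le> length (y # zs)\<close>] by auto
    finally have int: "path_image c \<inter> path_image d \<subseteq> {pos y}"
      using c d by (simp add: pic_def)
    show ?thesis
    proof (intro exI[of _ "c +++ d"] conjI)
      show "arc (c +++ d)"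
        using c d int by (intro arc_join) auto
      show "path_image (c +++ d) = pic (path_edges (x # y # zs))"
        using c d by (simp add: path_image_join pic_def)
    qed (use c d in auto)
  qed
qed auto

text \<open>The labels of the face system are here the open regions themselves. This is the
  invariant carried through the ear decomposition; afterwards only the face system is kept.\<close>

definition plane_faces :: "'v set set \<Rightarrow> complex set set \<Rightarrow> (complex set \<Rightarrow> 'v list) \<Rightarrow> bool" where
  "plane_faces H F B \<longleftrightarrow> face_system H F B \<and> H \<subseteq> E \<and> disjoint F \<and> \<Union>F = - pic H \<and>
     (\<forall>f\<in>F. open f \<and> connected f \<and> f \<noteq> {} \<and> frontier f = pic (cycle_edges (B f)))"

text \<open>The condition on \<open>as\<close> and \<open>bs\<close> excludes the degenerate cycle
  on two vertices, both of whose halves would be the same drawn edge.\<close>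

lemma two_paths_arcs:
  assumes d: "distinct (p # as @ q # bs)" and E: "cycle_edges (p # as @ q # bs) \<subseteq> E"
    and ne: "as \<noteq> [] \<or> bs \<noteq> []"
  obtains c1 c2 where "arc c1" "pathstart c1 = pos p" "pathfinish c1 = pos q" "path_image c1 = pic (path_edges (p # as @ [q]))"
    "arc c2" "pathstart c2 = pos p" "pathfinish c2 = pos q" "path_image c2 = pic (path_edges (q # bs @ [p]))"
    "path_image c1 \<inter> path_image c2 = {pos p, pos q}"
proof -
  have sub: "path_edges (p # as @ [q]) \<subseteq> E" "path_edges (q # bs @ [p]) \<subseteq> E"
    using E unfolding cycle_edges_two_paths by auto
  have dd: "distinct (p # as @ [q])" "distinct (q # bs @ [p])"
    using d by auto
  obtain c1 where c1: "arc c1" "pathstart c1 = pos p" "pathfinish c1 = pos q" "path_image c1 = pic (path_edges (p # as @ [q]))"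
    using path_arc[OF dd(1) _ sub(1)] by auto
  obtain c2 where c2: "arc c2" "pathstart c2 = pos q" "pathfinish c2 = pos p" "path_image c2 = pic (path_edges (q # bs @ [p]))"
    using path_arc[OF dd(2) _ sub(2)] by auto
  have U: "\<Union> (path_edges (p # as @ [q])) = set (p # as @ [q])" "\<Union> (path_edges (q # bs @ [p])) = set (q # bs @ [p])"
    by (intro Union_path_edges; simp)+
  have disj: "path_edges (p # as @ [q]) \<inter> path_edges (q # bs @ [p]) = {}"
  proof (rule ccontr)
    assume "path_edges (p # as @ [q]) \<inter> path_edges (q # bs @ [p]) \<noteq> {}"
    then obtain e where e: "e \<in> path_edges (p # as @ [q])" "e \<in> path_edges (q # bs @ [p])"
      by blast
    \<comment> \<open>A common edge must join \<open>p\<close> to \<open>q\<close>. It is then the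
      first edge of both paths, so that neither path has inner vertices.\<close>
    have "e \<subseteq> {p, q}"
      using path_edges_subset[OF e(1)] path_edges_subset[OF e(2)] d by auto
    moreover have "card e = 2"
      using card_path_edge[OF e(1) dd(1)] .
    ultimately have "e = {p, q}"
      using d by (intro card_seteq) auto
    then have e1: "{p, q} \<in> {e \<in> path_edges (p # as @ [q]). p \<in> e}" and e2: "{q, p} \<in> {e \<in> path_edges (q # bs @ [p]). q \<in> e}"
      using e by (auto simp: insert_commute)
    have snoc_not_Nil: "xs @ [z] \<noteq> []" for xs :: "'v list" and z
      by simp
    have "{p, q} = {p, hd (as @ [q])}" "{q, p} = {q, hd (bs @ [p])}"
      using e1[unfolded path_edges_at_start[OF dd(1) snoc_not_Nil]] e2[unfolded path_edges_at_start[OF dd(2) snoc_not_Nil]]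
      by simp_all
    then have hds: "hd (as @ [q]) = q" "hd (bs @ [p]) = p"
      by (auto simp: doubleton_eq_iff)
    have "as = []"
      using hds(1) d by (cases as) auto
    moreover have "bs = []"
      using hds(2) d by (cases bs) auto
    ultimately show False
      using ne by simp
  qed
  have "pic (path_edges (p # as @ [q])) \<inter> pic (path_edges (q # bs @ [p])) \<subseteq> {pos p, pos q}"
    using pic_Int[OF sub disj] d unfolding U by auto
  moreover have "pos p \<in> path_image c1" "pos q \<in> path_image c1" "pos p \<in> path_image c2" "pos q \<in> path_image c2"
    using c1 c2 pathstart_in_path_image pathfinish_in_path_image by metis+
  ultimately have "path_image c1 \<inter> path_image c2 = {pos p, pos q}"
    using c1(4) c2(4) by auto
  then show thesis
    using c1 c2 by (intro that[of c1 "reversepath c2"]) (simp_all add: arc_reversepath)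
qed

lemma plane_faces_cycle:
  assumes "distinct xs" "3 \<le> length xs" "cycle_edges xs \<subseteq> E"
  shows "\<exists>F B. plane_faces (cycle_edges xs) F B"
proof -
  obtain x y zs where xs: "xs = x # [] @ y # zs"
    using assms(2) by (cases xs rule: path_edges.cases) auto
  then have "zs \<noteq> []"
    using assms(2) by auto
  obtain c1 c2 where c1: "arc c1" "pathstart c1 = pos x" "pathfinish c1 = pos y" "path_image c1 = pic (path_edges (x # [] @ [y]))"
    and c2: "arc c2" "pathstart c2 = pos x" "pathfinish c2 = pos y" "path_image c2 = pic (path_edges (y # zs @ [x]))"
    and int: "path_image c1 \<inter> path_image c2 = {pos x, pos y}"
    using two_paths_arcs[of x "[]" y zs] assms(1,3) \<open>zs \<noteq> []\<close> unfolding xs by metis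
  define J where "J = path_image c1 \<union> path_image c2"
  have J: "J = pic (cycle_edges xs)"
    unfolding J_def c1(4) c2(4) xs cycle_edges_two_paths pic_Un ..
  note Jo = Jordan_two_arcs[OF c1(1-3) c2(1-3) int, folded J_def]
  have "inside J \<noteq> outside J"
    using Jo(3) inside_Int_outside[of J] by (metis Int_absorb)
  then have "face_system (cycle_edges xs) {inside J, outside J} (\<lambda>_. xs)"
    using assms by (intro face_system_cycle)
  moreover have "\<Union>{inside J, outside J} = - pic (cycle_edges xs)"
    unfolding J[symmetric] using Jo(10) by simp
  moreover have "disjoint {inside J, outside J}"
    using Jo(9) by (simp add: disjoint_def Int_commute)
  moreover have "open f \<and> connected f \<and> f \<noteq> {} \<and> frontier f = pic (cycle_edges xs)" if "f \<in> {inside J, outside J}" for f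
    unfolding J[symmetric] using that Jo(3-8,11,12) by (elim insertE emptyE) simp_all
  ultimately have "plane_faces (cycle_edges xs) {inside J, outside J} (\<lambda>_. xs)"
    unfolding plane_faces_def using assms(3) by simp
  then show ?thesis
    by blast
qed

lemma rotate_cycle:
  assumes "distinct xs" "p \<in> set xs" "q \<in> set xs" "p \<noteq> q"
  obtains as bs where "distinct (p # as @ q # bs)" "cycle_edges xs = cycle_edges (p # as @ q # bs)"
    "length xs = length (p # as @ q # bs)"
proof -
  obtain us ws where xs: "xs = us @ p # ws"
    using assms(2) by (meson split_list)
  have "q \<in> set (ws @ us)"
    using assms(3,4) xs by auto
  then obtain as bs where asbs: "ws @ us = as @ q # bs"
    by (meson split_list)
  have "cycle_edges xs = cycle_edges ((p # ws) @ us)"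
    using cycle_edges_rotate[of us "p # ws"] xs by simp
  then have "cycle_edges xs = cycle_edges (p # as @ q # bs)"
    using asbs by simp
  moreover have "distinct (p # ws @ us)" "length xs = length (p # ws @ us)"
    using assms(1) xs by auto
  ultimately show thesis
    using that asbs by metis
qed

text \<open>Without its ends the drawn ear is connected and misses the drawing of \<open>H\<close>,
  so it lies in one region \<open>f\<close>. Its ends are in the closure of \<open>f\<close> but on
  the drawing of \<open>H\<close>, hence on the frontier of \<open>f\<close>, which is the drawn
  boundary cycle. So \<open>p\<close> and \<open>q\<close> lie on that cycle and the ear is a
  crosscut of \<open>f\<close>.\<close>

lemma plane_faces_ear:
  assumes pf: "plane_faces H F B"
    and ear: "distinct (p # ps @ [q])" "p \<in> \<Union>H" "q \<in> \<Union>H" "set ps \<inter> \<Union>H = {}"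
      "path_edges (p # ps @ [q]) \<subseteq> E" "path_edges (p # ps @ [q]) \<inter> H = {}"
  shows "\<exists>F B. plane_faces (H \<union> path_edges (p # ps @ [q])) F B"
proof -
  let ?P = "path_edges (p # ps @ [q])"
  have fs: "face_system H F B" and HE: "H \<subseteq> E" and dF: "disjoint F" and UF: "\<Union>F = - pic H"
    and face: "\<And>f. f \<in> F \<Longrightarrow> open f" "\<And>f. f \<in> F \<Longrightarrow> connected f" "\<And>f. f \<in> F \<Longrightarrow> f \<noteq> {}"
      "\<And>f. f \<in> F \<Longrightarrow> frontier f = pic (cycle_edges (B f))"
    using pf unfolding plane_faces_def by simp_all
  have pqV: "p \<in> V" "q \<in> V"
    using ear(2,3) HE edge_subset by auto
  obtain c where c: "arc c" "pathstart c = pos p" "pathfinish c = pos q" "path_image c = pic ?P"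
    using path_arc[OF ear(1) _ ear(5)] by auto
  define X where "X = path_image c - {pos p, pos q}"
  have "pic ?P \<inter> pic H \<subseteq> pos ` (\<Union>?P \<inter> \<Union>H)"
    using pic_Int[OF ear(5) HE ear(6)] .
  also have "\<dots> \<subseteq> {pos p, pos q}"
    using Union_path_edges[of "p # ps @ [q]"] ear(4) by auto
  finally have XH: "X \<inter> pic H = {}"
    using c(4) by (auto simp: X_def)
  have "connected X"
    using connected_simple_path_endless[OF arc_imp_simple_path[OF c(1)]] c by (simp add: X_def)
  have "X \<noteq> {}"
    using arc_has_inner_point[OF c(1)] c by (auto simp: X_def)
  then obtain x where "x \<in> X"
    by auto
  then obtain f where f: "f \<in> F" "x \<in> f"
    using XH UF by auto
  have "X \<subseteq> f"
  proof -
    have "open (\<Union>(F - {f}))"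
      using face(1) by (intro open_Union) auto
    moreover have "X \<subseteq> f \<union> \<Union>(F - {f})"
      using XH UF by blast
    moreover have "f \<inter> \<Union>(F - {f}) = {}"
      using dF f(1) unfolding disjoint_def by auto
    ultimately have "f \<inter> X = {} \<or> \<Union>(F - {f}) \<inter> X = {}"
      using connectedD[OF \<open>connected X\<close> face(1)[OF f(1)], of "\<Union>(F - {f})"] by auto
    then show ?thesis
      using \<open>X \<subseteq> f \<union> \<Union>(F - {f})\<close> \<open>x \<in> X\<close> f(2) by blast
  qed
  \<comment> \<open>An arc is the closure of its interior, so its ends are limits of points of
    \<open>f\<close>.\<close>
  have "path_image c \<subseteq> closure X"
  proof -
    have "continuous_on (closure {0<..<1}) c"
      using c(1) by (simp add: arc_def path_def)
    moreover have "c ` {0<..<1} \<subseteq> closure X"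
    proof
      fix z assume "z \<in> c ` {0<..<1}"
      then obtain t where t: "0 < t" "t < 1" "z = c t"
        by auto
      then have "c t \<noteq> c 0" "c t \<noteq> c 1"
        using c(1) by (auto simp: arc_def dest: inj_onD[of _ _ t 0] inj_onD[of _ _ t 1])
      then have "z \<in> X"
        using t c(2,3) by (auto simp: X_def path_image_def pathstart_def pathfinish_def)
      then show "z \<in> closure X"
        using closure_subset by auto
    qed
    ultimately have "c ` closure {0<..<1} \<subseteq> closure X"
      by (intro image_closure_subset) auto
    then show ?thesis
      by (simp add: path_image_def)
  qed
  then have "pos p \<in> closure f" "pos q \<in> closure f"
    using closure_mono[OF \<open>X \<subseteq> f\<close>] c pathstart_in_path_image[of c] pathfinish_in_path_image[of c] by auto
  moreover have "pos p \<notin> f" "pos q \<notin> f"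
    using pos_in_pic_iff[OF HE] pqV ear(2,3) f(1) UF by auto
  ultimately have "pos p \<in> frontier f" "pos q \<in> frontier f"
    using face(1)[OF f(1)] by (auto simp: frontier_def interior_open)
  moreover have BfH: "cycle_edges (B f) \<subseteq> H"
    using face_systemD(6)[OF fs f(1)] .
  ultimately have "p \<in> \<Union>(cycle_edges (B f))" "q \<in> \<Union>(cycle_edges (B f))"
    using pos_in_pic_iff[of "cycle_edges (B f)"] pqV HE face(4)[OF f(1)] by auto
  moreover have "\<Union>(cycle_edges (B f)) = set (B f)"
    using face_systemD(5)[OF fs f(1)] by (intro Union_cycle_edges) simp
  ultimately have "p \<in> set (B f)" "q \<in> set (B f)"
    by auto
  moreover have "p \<noteq> q"
    using ear(1) by auto
  ultimately obtain as bs where asbs: "distinct (p # as @ q # bs)" "cycle_edges (B f) = cycle_edges (p # as @ q # bs)"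
      "length (B f) = length (p # as @ q # bs)"
    using rotate_cycle[OF face_systemD(4)[OF fs f(1)]] by metis
  have "as \<noteq> [] \<or> bs \<noteq> []"
    using asbs(3) face_systemD(5)[OF fs f(1)] by auto
  moreover have "cycle_edges (p # as @ q # bs) \<subseteq> E"
    using BfH HE asbs(2) by simp
  ultimately obtain c1 c2 where
      c1: "arc c1" "pathstart c1 = pos p" "pathfinish c1 = pos q" "path_image c1 = pic (path_edges (p # as @ [q]))"
    and c2: "arc c2" "pathstart c2 = pos p" "pathfinish c2 = pos q" "path_image c2 = pic (path_edges (q # bs @ [p]))"
    and int: "path_image c1 \<inter> path_image c2 = {pos p, pos q}"
    using two_paths_arcs[OF asbs(1)] by metis
  have "frontier f = path_image c1 \<union> path_image c2"
    unfolding face(4)[OF f(1)] asbs(2) cycle_edges_two_paths pic_Un c1(4) c2(4) ..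
  from crosscut_splits_face[OF c1(1-3) c2(1-3) c(1-3) int face(1-3)[OF f(1)] this \<open>X \<subseteq> f\<close>[unfolded X_def]]
  obtain f1 f2 where f1: "open f1" "connected f1" "f1 \<noteq> {}" "frontier f1 = path_image c1 \<union> path_image c"
    and f2: "open f2" "connected f2" "f2 \<noteq> {}" "frontier f2 = path_image c2 \<union> path_image c"
    and f12: "f1 \<inter> f2 = {}" "f1 \<union> f2 = f - path_image c"
    by metis
  have other: "g \<inter> f = {}" if "g \<in> F - {f}" for g
    using dF f(1) that unfolding disjoint_def by auto
  have "f1 \<noteq> f2"
    using f1(3) f12(1) by auto
  have sub: "f1 \<subseteq> f" "f2 \<subseteq> f"
    using f12(2) by auto
  have new: "f1 \<notin> F - {f}" "f2 \<notin> F - {f}"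
    using other sub f1(3) f2(3) by blast+
  have "distinct ps"
    using ear(1) by auto
  let ?F = "insert f1 (insert f2 (F - {f}))"
  let ?B = "B(f1 := p # ps @ q # rev as, f2 := p # ps @ q # bs)"
  have fs': "face_system (H \<union> ?P) ?F ?B"
    using face_system_ear[OF fs f(1) asbs(1,2) \<open>distinct ps\<close> ear(4,6) \<open>f1 \<noteq> f2\<close> new] .
  have dF': "disjoint ?F"
  proof -
    have "g \<inter> f1 = {}" "g \<inter> f2 = {}" if "g \<in> F - {f}" for g
      using other[OF that] sub by auto
    moreover have "g \<inter> h = {}" if "g \<in> F - {f}" "h \<in> F - {f}" "g \<noteq> h" for g h
      using dF that unfolding disjoint_def by auto
    ultimately show ?thesis
      using f12(1) unfolding disjoint_def by (auto simp: Int_commute)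
  qed
  have UF': "\<Union>?F = - pic (H \<union> ?P)"
  proof -
    have "path_image c \<subseteq> f \<union> pic H"
      using \<open>X \<subseteq> f\<close> pos_in_pic_iff[OF HE] pqV ear(2,3) by (auto simp: X_def)
    then have "path_image c \<inter> \<Union>(F - {f}) = {}"
      using other UF by blast
    then have "\<Union>?F = \<Union>F - path_image c"
      using f12(2) f(1) by auto
    then show ?thesis
      unfolding UF pic_Un c(4)[symmetric] by auto
  qed
  have "pic (path_edges (q # rev as @ [p])) = path_image c1"
    using path_edges_rev[of "p # as @ [q]"] c1(4) by simp
  then have fr: "frontier f1 = pic (cycle_edges (p # ps @ q # rev as))" "frontier f2 = pic (cycle_edges (p # ps @ q # bs))"
    unfolding f1(4) f2(4) cycle_edges_two_paths pic_Un c(4) c2(4) by auto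
  have "open g \<and> connected g \<and> g \<noteq> {} \<and> frontier g = pic (cycle_edges (?B g))" if gF: "g \<in> ?F" for g
  proof -
    consider "g = f1" | "g = f2" | "g \<in> F" "g \<noteq> f1" "g \<noteq> f2"
      using gF by blast
    then show ?thesis
      using f1(1-3) f2(1-3) \<open>f1 \<noteq> f2\<close> fr face[of g] by cases simp_all
  qed
  then have "\<forall>g\<in>?F. open g \<and> connected g \<and> g \<noteq> {} \<and> frontier g = pic (cycle_edges (?B g))"
    by (rule ballI)
  moreover have "H \<union> ?P \<subseteq> E"
    using HE ear(5) by simp
  ultimately have "plane_faces (H \<union> ?P) ?F ?B"
    unfolding plane_faces_def using fs' dF' UF' by (intro conjI)
  then show ?thesis
    by blast
qed

end

section \<open>Ear decompositions and end blocks\<close>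

text \<open>Ears are open: distinctness forces \<open>p \<noteq> q\<close>, so all graphs built this
  way are 2-connected. An ear with \<open>ps = []\<close> is a chord.\<close>

inductive ear_built :: "'v set set \<Rightarrow> 'v set set \<Rightarrow> bool" for E where
  cycle: "distinct xs \<Longrightarrow> 3 \<le> length xs \<Longrightarrow> cycle_edges xs \<subseteq> E \<Longrightarrow> ear_built E (cycle_edges xs)"
| ear: "ear_built E H \<Longrightarrow> distinct (p # ps @ [q]) \<Longrightarrow> p \<in> \<Union>H \<Longrightarrow> q \<in> \<Union>H \<Longrightarrow> set ps \<inter> \<Union>H = {} \<Longrightarrow>
    path_edges (p # ps @ [q]) \<subseteq> E \<Longrightarrow> path_edges (p # ps @ [q]) \<inter> H = {} \<Longrightarrow>
    ear_built E (H \<union> path_edges (p # ps @ [q]))"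

lemma ear_built_subset: "ear_built E H \<Longrightarrow> H \<subseteq> E"
  by (induction rule: ear_built.induct) auto

lemma ear_built_mono: "ear_built E H \<Longrightarrow> E \<subseteq> E' \<Longrightarrow> ear_built E' H"
proof (induction rule: ear_built.induct)
  case (cycle xs)
  then show ?case
    by (intro ear_built.cycle) auto
next
  case (ear H p ps q)
  then show ?case
    by (intro ear_built.ear) simp_all
qed

lemma ear_built_card_verts: "ear_built E H \<Longrightarrow> finite (\<Union>H) \<and> 3 \<le> card (\<Union>H)"
proof (induction rule: ear_built.induct)
  case (cycle xs)
  then show ?case
    by (simp add: Union_cycle_edges distinct_card)
next
  case (ear H p ps q)
  have "finite (\<Union> (H \<union> path_edges (p # ps @ [q])))"
    using ear Union_path_edges[of "p # ps @ [q]"] by simp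
  moreover from this have "card (\<Union>H) \<le> card (\<Union> (H \<union> path_edges (p # ps @ [q])))"
    by (rule card_mono) auto
  ultimately show ?case
    using ear by linarith
qed

lemma path_edges_Cons: "ps \<noteq> [] \<Longrightarrow> path_edges (a # ps) = insert {a, hd ps} (path_edges ps)"
  by (cases ps) auto

lemma path_edges_snoc_last: "ps \<noteq> [] \<Longrightarrow> path_edges (ps @ [y]) = insert {last ps, y} (path_edges ps)"
  using path_edges_snoc[of "butlast ps" "last ps" y] by (cases ps rule: rev_cases) auto

lemma card_2_other:
  assumes "card e = 2" "v \<in> e"
  obtains w where "e = {v, w}" "v \<noteq> w"
proof -
  obtain a b where ab: "e = {a, b}" "a \<noteq> b"
    using assms(1) by (meson card_2_iff)
  show thesis
  proof (cases "v = a")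
    case True
    then show ?thesis
      using ab that by blast
  next
    case False
    then have "v = b"
      using assms(2) ab(1) by simp
    then show ?thesis
      using ab that[of a] by (simp add: insert_commute)
  qed
qed

text \<open>Take a longest path. All neighbours of its first vertex lie on it, and one that is not
  the second vertex closes a cycle. The vertex \<open>x\<close> is exempt from the degree condition
  because the cut vertex of an end block may have few edges there.\<close>

lemma ex_cycle:
  assumes "finite U" "S \<subseteq> U" "v0 \<in> S" "U \<subseteq> insert x S"
    and edges: "\<And>e. e \<in> E \<Longrightarrow> e \<subseteq> U \<and> card e = 2"
    and deg: "\<And>v. v \<in> S \<Longrightarrow> 2 \<le> vdegree E v"
  shows "\<exists>xs. distinct xs \<and> 3 \<le> length xs \<and> cycle_edges xs \<subseteq> E"
proof -
  define P where "P xs \<longleftrightarrow> distinct xs \<and> path_edges xs \<subseteq> E \<and> set xs \<subseteq> U \<and> xs \<noteq> []" for xs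
  have len: "length xs < Suc (card U)" if "P xs" for xs
    using that card_mono[OF assms(1), of "set xs"] by (simp add: P_def distinct_card)
  have "P [v0]"
    using assms(2,3) by (auto simp: P_def)
  then obtain xs where xs: "P xs" and max: "\<And>ys. P ys \<Longrightarrow> length ys \<le> length xs"
    using ex_has_greatest_nat[of P "[v0]" length "Suc (card U)"] len by blast
  have nbr: "\<exists>w. {v, w} \<in> E \<and> w \<noteq> y" if v: "v \<in> S" for v y
  proof (rule ccontr)
    assume neg: "\<nexists>w. {v, w} \<in> E \<and> w \<noteq> y"
    have "{e \<in> E. v \<in> e} \<subseteq> {{v, y}}"
    proof
      fix e assume e: "e \<in> {e \<in> E. v \<in> e}"
      then obtain w where "e = {v, w}"
        using edges card_2_other by (metis mem_Collect_eq)
      moreover from this have "w = y"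
        using e neg by simp
      ultimately show "e \<in> {{v, y}}"
        by simp
    qed
    then have "card {e \<in> E. v \<in> e} \<le> card {{v, y}}"
      by (intro card_mono) simp_all
    then have "vdegree E v \<le> 1"
      by (simp add: vdegree_def)
    then show False
      using deg[OF v] by simp
  qed
  have two: "2 \<le> length xs"
  proof -
    obtain w where w: "{v0, w} \<in> E" "w \<noteq> v0"
      using nbr[OF assms(3)] by blast
    then have "P [v0, w]"
      using edges[of "{v0, w}"] by (auto simp: P_def)
    then show ?thesis
      using max by fastforce
  qed
  \<comment> \<open>At most one end of the path is \<open>x\<close>; reversal, if necessary, makes
    it start in \<open>S\<close>.\<close>
  obtain ys where ys: "P ys" "length ys = length xs" "hd ys \<in> S"
  proof (cases "hd xs \<in> S")
    case True
    then show ?thesis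
      using that xs by blast
  next
    case False
    have ends: "hd xs \<in> U" "last xs \<in> U" "hd xs \<noteq> last xs"
    proof -
      obtain a b zs where "xs = a # b # zs"
        using two by (cases xs rule: path_edges.cases) auto
      then show "hd xs \<in> U" "last xs \<in> U" "hd xs \<noteq> last xs"
        using xs last_in_set[of "b # zs"] unfolding P_def by auto
    qed
    have "last xs \<in> S"
      using ends False assms(4) by auto
    then show ?thesis
      using that[of "rev xs"] xs by (auto simp: P_def path_edges_rev hd_rev)
  qed
  obtain v y zs where ysd: "ys = v # y # zs"
    using two ys(2) by (cases ys rule: path_edges.cases) auto
  obtain w where w: "{v, w} \<in> E" "w \<noteq> y"
    using nbr[of v y] ys(3) ysd by auto
  have "w \<noteq> v"
    using edges[OF w(1)] by auto
  have "w \<in> set ys"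
  proof (rule ccontr)
    assume "w \<notin> set ys"
    then have "P (w # ys)"
      using ys(1) w(1) edges[OF w(1)] unfolding P_def ysd by (auto simp: insert_commute)
    then show False
      using max ys(2) by fastforce
  qed
  then have "w \<in> set zs"
    using w(2) \<open>w \<noteq> v\<close> ysd by simp
  then obtain as bs where zs: "zs = as @ w # bs"
    by (meson split_list)
  let ?c = "v # y # as @ [w]"
  have "path_edges (v # y # as @ [w]) \<subseteq> E"
    using ys(1) path_edges_append[of "y # as" w bs] unfolding P_def ysd zs by auto
  then have "cycle_edges ?c \<subseteq> E"
    using cycle_edges_Cons[of "y # as @ [w]" v] w(1) by simp
  moreover have "distinct ?c"
    using ys(1) unfolding P_def ysd zs by auto
  ultimately show ?thesis
    by (intro exI[of _ ?c]) simp
qed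

text \<open>Take a vertex \<open>x\<close> and a nonempty set \<open>S\<close> as small as possible whose neighbours all lie in
  \<open>insert x S\<close>, and a maximal ear-built subgraph \<open>H\<close> on these vertices. An edge of the graph leaving
  \<open>H\<close> at \<open>v \<noteq> x\<close> leads to a part of \<open>S\<close> attached to \<open>H\<close> only at \<open>v\<close> (otherwise there would be
  another ear), so \<open>v\<close> would separate a smaller set.\<close>

lemma ex_end_block:
  fixes E :: "'v set set"
  assumes "finite E" "E \<noteq> {}" and edges: "\<And>e. e \<in> E \<Longrightarrow> card e = 2"
    and deg: "\<And>v. v \<in> \<Union>E \<Longrightarrow> 3 \<le> vdegree E v"
  shows "\<exists>H x. ear_built E H \<and> (\<forall>v\<in>\<Union>H. v \<noteq> x \<longrightarrow> {e \<in> E. v \<in> e} \<subseteq> H)"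
proof -
  \<comment> \<open>All edges that leave \<open>S\<close> go to \<open>x\<close>. The existence of
    such a pair is trivial, with all vertices but \<open>x\<close> as \<open>S\<close>; only a pair
    with smallest \<open>S\<close> yields an end block.\<close>
  define sep where "sep x S \<longleftrightarrow> S \<noteq> {} \<and> S \<subseteq> \<Union>E \<and> x \<notin> S \<and> x \<in> \<Union>E \<and> (\<forall>v\<in>S. \<forall>w. {v, w} \<in> E \<longrightarrow> w \<in> insert x S)"
    for x and S :: "'v set"
  have finU: "finite (\<Union>E)"
    using assms(1) edges by (metis card.infinite finite_Union zero_neq_numeral)
  obtain x0 y0 where "{x0, y0} \<in> E" "x0 \<noteq> y0"
    using assms(2) edges by (metis card_2_iff ex_in_conv)
  then have "sep x0 (\<Union>E - {x0})"
    unfolding sep_def by auto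
  then obtain x S where S: "sep x S" and min: "\<And>x' S'. sep x' S' \<Longrightarrow> card S \<le> card S'"
    using ex_has_least_nat[of "\<lambda>(x, S). sep x S" "(x0, \<Union>E - {x0})" "\<lambda>(x, S). card S"] by auto
  have finS: "finite S"
    using S finU finite_subset unfolding sep_def by blast
  have smaller: "\<not> sep v T" if "T \<subseteq> S" "z \<in> S" "z \<notin> T" for v T z
  proof
    assume "sep v T"
    moreover have "card T < card S"
      using that finS by (intro psubset_card_mono) auto
    ultimately show False
      using min[of v T] by simp
  qed
  define U where "U = insert x S"
  define EU where "EU = {e \<in> E. e \<subseteq> U}"
  have nbrU: "w \<in> U \<and> {v, w} \<in> EU" if "v \<in> S" "{v, w} \<in> E" for v w
    using S that unfolding sep_def U_def EU_def by auto
  have starU: "{e \<in> EU. v \<in> e} = {e \<in> E. v \<in> e}" if "v \<in> S" for v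
  proof -
    have "e \<in> EU" if "e \<in> E" "v \<in> e" for e
    proof -
      obtain w where "e = {v, w}"
        using card_2_other[OF edges[OF \<open>e \<in> E\<close>] \<open>v \<in> e\<close>] by metis
      then show ?thesis
        using nbrU[OF \<open>v \<in> S\<close>] \<open>e \<in> E\<close> by simp
    qed
    then show ?thesis
      by (auto simp: EU_def)
  qed
  obtain v0 where "v0 \<in> S"
    using S by (auto simp: sep_def)
  have "\<exists>xs. distinct xs \<and> 3 \<le> length xs \<and> cycle_edges xs \<subseteq> EU"
  proof (rule ex_cycle[of U S v0 x EU])
    show "2 \<le> vdegree EU v" if "v \<in> S" for v
    proof -
      have "vdegree EU v = vdegree E v"
        using starU[OF that] by (simp add: vdegree_def)
      moreover have "v \<in> \<Union>E"
        using S that by (auto simp: sep_def)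
      ultimately show ?thesis
        using deg[of v] by simp
    qed
  qed (use finS edges \<open>v0 \<in> S\<close> in \<open>auto simp: U_def EU_def\<close>)
  then obtain xs where "ear_built EU (cycle_edges xs)"
    using ear_built.cycle by blast
  moreover have "card H < Suc (card EU)" if "ear_built EU H" for H
  proof -
    have "finite EU"
      using assms(1) by (simp add: EU_def)
    then show ?thesis
      using card_mono[OF _ ear_built_subset[OF that]] by simp
  qed
  ultimately obtain H where H: "ear_built EU H" and max: "\<And>H'. ear_built EU H' \<Longrightarrow> card H' \<le> card H"
    using ex_has_greatest_nat[of "ear_built EU" "cycle_edges xs" card "Suc (card EU)"] by blast
  have HEU: "H \<subseteq> EU"
    using ear_built_subset[OF H] .
  have "finite H"
    using finite_subset[OF HEU] assms(1) by (simp add: EU_def)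
  have HU: "\<Union>H \<subseteq> U"
    using HEU by (auto simp: EU_def)
  have no_ear: False if "distinct (p # ps @ [q])" "p \<in> \<Union>H" "q \<in> \<Union>H" "set ps \<inter> \<Union>H = {}"
    "path_edges (p # ps @ [q]) \<subseteq> EU" "path_edges (p # ps @ [q]) \<inter> H = {}" for p ps q
  proof -
    have "card (H \<union> path_edges (p # ps @ [q])) = card H + card (path_edges (p # ps @ [q]))"
      using \<open>finite H\<close> that(6) by (simp add: card_Un_disjoint Int_commute)
    moreover have "0 < card (path_edges (p # ps @ [q]))"
      using card_path_edges[OF that(1)] by simp
    ultimately show False
      using max[OF ear_built.ear[OF H that]] by simp
  qed
  have "{e \<in> E. v \<in> e} \<subseteq> H" if v: "v \<in> \<Union>H" "v \<noteq> x" for v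
  proof (rule ccontr)
    assume "\<not> {e \<in> E. v \<in> e} \<subseteq> H"
    then obtain e where e: "e \<in> E" "v \<in> e" "e \<notin> H"
      by auto
    obtain w where w: "e = {v, w}" "v \<noteq> w"
      using card_2_other[OF edges[OF e(1)] e(2)] by metis
    have "v \<in> S"
      using v HU by (auto simp: U_def)
    then have vw: "{v, w} \<in> EU" "w \<in> U"
      using nbrU e(1) w(1) by auto
    have wH: "w \<notin> \<Union>H"
      using no_ear[of v "[]" w] v vw e(3) w by auto
    \<comment> \<open>The vertices that can be reached from \<open>w\<close> inside \<open>U\<close>
      without touching \<open>H\<close>.\<close>
    define K where "K = {k. \<exists>ps. distinct ps \<and> ps \<noteq> [] \<and> hd ps = w \<and> last ps = k \<and> set ps \<subseteq> U - \<Union>H \<and> path_edges ps \<subseteq> EU}"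
    have "w \<in> K"
      unfolding K_def using wH vw(2) by (intro CollectI exI[of _ "[w]"]) auto
    have KU: "K \<subseteq> U - \<Union>H"
      unfolding K_def by (auto dest: last_in_set)
    have closed: "t \<in> K" if k: "k \<in> K" and t: "{k, t} \<in> EU" "t \<in> U - \<Union>H" for k t
    proof -
      obtain ps where ps: "distinct ps" "ps \<noteq> []" "hd ps = w" "last ps = k" "set ps \<subseteq> U - \<Union>H" "path_edges ps \<subseteq> EU"
        using k unfolding K_def by auto
      show ?thesis
      proof (cases "t \<in> set ps")
        case True
        then obtain as bs where asbs: "ps = as @ t # bs"
          by (meson split_list)
        then have "path_edges (as @ [t]) \<subseteq> EU"
          using ps(6) path_edges_append[of as t bs] by simp
        moreover have "hd (as @ [t]) = w"
          using ps(3) asbs by (cases as) auto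
        ultimately show ?thesis
          unfolding K_def using ps(1,5) asbs by (intro CollectI exI[of _ "as @ [t]"]) auto
      next
        case False
        then show ?thesis
          unfolding K_def using ps t path_edges_snoc_last[OF ps(2), of t] by (intro CollectI exI[of _ "ps @ [t]"]) auto
      qed
    qed
    \<comment> \<open>A path from \<open>w\<close> to \<open>k\<close> off \<open>H\<close>,
      extended by the edges \<open>{v, w}\<close> and \<open>{k, y}\<close>, would be an ear of
      \<open>H\<close> from \<open>v\<close> to \<open>y\<close>.\<close>
    have attach: "y = v" if k: "k \<in> K" and y: "{k, y} \<in> EU" "y \<in> \<Union>H" for k y
    proof (rule ccontr)
      assume "y \<noteq> v"
      obtain ps where ps: "distinct ps" "ps \<noteq> []" "hd ps = w" "last ps = k" "set ps \<subseteq> U - \<Union>H" "path_edges ps \<subseteq> EU"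
        using k unfolding K_def by auto
      have pe: "path_edges (v # ps @ [y]) = insert {v, w} (insert {k, y} (path_edges ps))"
        using path_edges_Cons[of "ps @ [y]" v] path_edges_snoc_last[OF ps(2), of y] ps(2,3,4) by simp
      have "k \<notin> \<Union>H"
        using k KU by auto
      have "f \<notin> H" if "f \<in> path_edges ps" for f
      proof
        assume "f \<in> H"
        then have "f \<subseteq> \<Union>H \<inter> set ps"
          using path_edges_subset[OF that] by auto
        then have "f = {}"
          using ps(5) by auto
        then show False
          using card_path_edge[OF that ps(1)] by simp
      qed
      then have "path_edges (v # ps @ [y]) \<inter> H = {}"
        unfolding pe using \<open>k \<notin> \<Union>H\<close> wH by auto
      moreover have "path_edges (v # ps @ [y]) \<subseteq> EU"
        unfolding pe using vw(1) y(1) ps(6) by simp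
      moreover have "distinct (v # ps @ [y])"
        using ps(1,5) v(1) y(2) \<open>y \<noteq> v\<close> by auto
      moreover have "set ps \<inter> \<Union>H = {}"
        using ps(5) by auto
      ultimately show False
        using no_ear[of v ps y] v(1) y(2) by simp
    qed
    have vE: "v \<in> \<Union>E"
      using e by auto
    have KE: "U \<subseteq> \<Union>E"
      using S by (auto simp: U_def sep_def)
    show False
    proof (cases "x \<in> K")
      case False
      then have KS: "K \<subseteq> S"
        using KU by (auto simp: U_def)
      have "v \<notin> K"
        using KU v(1) by auto
      moreover have "t \<in> insert v K" if "k \<in> K" "{k, t} \<in> E" for k t
      proof -
        have "t \<in> U" "{k, t} \<in> EU"
          using nbrU[of k t] that KS by auto
        then show ?thesis
          using attach[OF that(1), of t] closed[OF that(1), of t] by auto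
      qed
      ultimately have "sep v K"
        unfolding sep_def using \<open>w \<in> K\<close> KS vE KE by (auto simp: U_def)
      then show False
        using smaller[OF KS \<open>v \<in> S\<close> \<open>v \<notin> K\<close>] by simp
    next
      case True
      \<comment> \<open>If \<open>x\<close> belongs to the attached part, the complementary part is
        used instead. It avoids \<open>x\<close>, is joined to the rest only through
        \<open>v\<close>, and is nonempty because \<open>H\<close> has further vertices.\<close>
      define T where "T = U - K - {v}"
      have TS: "T \<subseteq> S"
        using True by (auto simp: T_def U_def)
      have "T \<noteq> {}"
      proof
        assume "T = {}"
        then have "\<Union>H \<subseteq> {v}"
          using HU KU by (auto simp: T_def)
        then have "card (\<Union>H) \<le> 1"
          using card_mono[of "{v}" "\<Union>H"] by simp
        then show False
          using ear_built_card_verts[OF H] by simp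
      qed
      moreover have "t \<in> insert v T" if "s \<in> T" "{s, t} \<in> E" for s t
      proof -
        have t: "t \<in> U" "{t, s} \<in> EU"
          using nbrU[of s t] that TS by (auto simp: insert_commute)
        have "t \<notin> K"
          using attach[of t s] closed[of t s] t(2) that(1) by (auto simp: T_def)
        then show ?thesis
          using t(1) by (auto simp: T_def)
      qed
      ultimately have "sep v T"
        unfolding sep_def using TS KE vE by (auto simp: T_def U_def)
      moreover have "v \<notin> T"
        by (simp add: T_def)
      ultimately show False
        using smaller[OF TS \<open>v \<in> S\<close>] by simp
    qed
  qed
  moreover have "ear_built E H"
    using ear_built_mono[OF H] by (auto simp: EU_def)
  ultimately show ?thesis
    by blast
qed

section \<open>Discharging\<close>

lemma cycle_edges_rev: "cycle_edges (x # rev xs) = cycle_edges (x # xs)"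
  using path_edges_rev[of "x # xs @ [x]"] by (simp add: cycle_edges_def)

lemma cycle_edges_from:
  assumes "v \<in> set xs" "distinct xs"
  obtains ys where "cycle_edges xs = cycle_edges (v # ys)" "distinct (v # ys)" "set xs = set (v # ys)"
    "length xs = length (v # ys)"
proof -
  obtain us ws where xs: "xs = us @ v # ws"
    using assms(1) by (meson split_list)
  then have "cycle_edges xs = cycle_edges (v # ws @ us)"
    using cycle_edges_rotate[of us "v # ws"] by simp
  then show thesis
    using assms(2) xs by (intro that[of "ws @ us"]) auto
qed

text \<open>After rotating \<open>a\<close> to the front, \<open>b\<close> is the second or the last
  vertex; in the latter case the rest is reversed.\<close>

lemma cycle_edges_starting_with:
  assumes e: "{a, b} \<in> cycle_edges xs" and xs: "distinct xs" "3 \<le> length xs"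
  obtains ys where "cycle_edges xs = cycle_edges (a # b # ys)" "distinct (a # b # ys)"
    "set xs = set (a # b # ys)" "length xs = length (a # b # ys)"
proof -
  have "a \<in> set xs"
    using e Union_cycle_edges[of xs] xs(2) by auto
  then obtain zs where zs: "cycle_edges xs = cycle_edges (a # zs)" "distinct (a # zs)" "set xs = set (a # zs)"
    "length xs = length (a # zs)"
    using cycle_edges_from xs(1) by metis
  have ne: "zs \<noteq> []"
    using zs(4) xs(2) by auto
  have "{a, b} \<in> {e \<in> cycle_edges (a # zs). a \<in> e}"
    using e zs(1) by simp
  also have "\<dots> = insert {a, last zs} {e \<in> path_edges (a # zs). a \<in> e}"
    unfolding cycle_edges_Cons[OF ne] by auto
  also have "\<dots> = {{a, last zs}, {a, hd zs}}"
    using path_edges_at_start[OF zs(2) ne] by simp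
  finally have "b = last zs \<or> b = hd zs"
    by (auto simp: doubleton_eq_iff)
  then show thesis
  proof
    assume "b = hd zs"
    then have "zs = b # tl zs"
      using ne by simp
    then show thesis
      using that[of "tl zs"] zs by simp
  next
    assume "b = last zs"
    then obtain us where us: "rev zs = b # us"
      using ne by (metis hd_rev list.collapse rev_is_Nil_conv)
    have "cycle_edges xs = cycle_edges (a # rev zs)" "distinct (a # rev zs)" "set xs = set (a # rev zs)"
      "length xs = length (a # rev zs)"
      using zs cycle_edges_rev[of a zs] by simp_all
    then show thesis
      unfolding us by (rule that)
  qed
qed

lemma double_count:
  assumes "finite A" "finite B"
  shows "(\<Sum>a\<in>A. card {b \<in> B. R a b}) = (\<Sum>b\<in>B. card {a \<in> A. R a b})"
proof -
  have "(\<Sum>a\<in>A. card {b \<in> B. R a b}) = (\<Sum>a\<in>A. \<Sum>b\<in>B. if R a b then 1 else 0)"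
    using assms by (simp add: sum.If_cases Int_def)
  also have "\<dots> = (\<Sum>b\<in>B. \<Sum>a\<in>A. if R a b then 1 else 0)"
    by (rule sum.swap)
  also have "\<dots> = (\<Sum>b\<in>B. card {a \<in> A. R a b})"
    using assms by (simp add: sum.If_cases Int_def)
  finally show ?thesis .
qed

text \<open>\<open>H\<close> will be the end block and \<open>x\<close> its cut vertex. The degree
  conditions spare \<open>x\<close>, whose remaining edges may lie outside \<open>H\<close>.\<close>

locale discharging =
  fixes H :: "'v set set" and F :: "'f set" and B :: "'f \<Rightarrow> 'v list" and x :: 'v
  assumes fs: "face_system H F B"
    and edge: "e \<in> H \<Longrightarrow> card e = 2"
    and deg3: "v \<in> \<Union>H \<Longrightarrow> v \<noteq> x \<Longrightarrow> 3 \<le> vdegree H v"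
    and heavy: "{u, v} \<in> H \<Longrightarrow> u \<noteq> x \<Longrightarrow> vdegree H u = 3 \<Longrightarrow> v = x \<or> 6 \<le> vdegree H v"
    and noC5: "\<not> has_cycle_of_length 5 H"
begin

abbreviation "d \<equiv> vdegree H"

section \<open>Faces and edges around a vertex\<close>

definition star :: "'v \<Rightarrow> 'v set set" where
  "star v = {e \<in> H. v \<in> e}"

definition corner :: "'v \<Rightarrow> 'f \<Rightarrow> 'v set set" where
  "corner v f = {e \<in> cycle_edges (B f). v \<in> e}"

definition faces_at :: "'v \<Rightarrow> 'f set" where
  "faces_at v = {f \<in> F. v \<in> set (B f)}"

lemma finite_HF: "finite H" "finite F"
  using face_systemD(1,2)[OF fs] .

lemma bd: "f \<in> F \<Longrightarrow> distinct (B f)" "f \<in> F \<Longrightarrow> 3 \<le> length (B f)" "f \<in> F \<Longrightarrow> cycle_edges (B f) \<subseteq> H"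
  by (rule face_systemD(4-6)[OF fs]; assumption)+

lemma Union_bd: "f \<in> F \<Longrightarrow> \<Union> (cycle_edges (B f)) = set (B f)"
  using bd(2)[of f] by (simp add: Union_cycle_edges)

lemma finite_verts: "finite (\<Union>H)"
  using finite_HF(1) edge by (metis card.infinite finite_Union zero_neq_numeral)

lemma corner_subset: "f \<in> F \<Longrightarrow> corner v f \<subseteq> star v"
  using bd(3)[of f] by (auto simp: corner_def star_def)

lemma card_star: "card (star v) = d v"
  by (simp add: star_def vdegree_def)

lemma finite_star: "finite (star v)"
  using finite_HF(1) by (simp add: star_def)

lemma card_corner: "f \<in> faces_at v \<Longrightarrow> card (corner v f) = 2"
proof -
  assume "f \<in> faces_at v"
  then have f: "f \<in> F" "v \<in> set (B f)"
    by (auto simp: faces_at_def)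
  obtain a b where "a \<noteq> b" "{e \<in> cycle_edges (B f). v \<in> e} = {{v, a}, {v, b}}"
    using cycle_edges_at[OF bd(1,2)[OF f(1)] f(2)] by metis
  then show ?thesis
    by (simp add: corner_def doubleton_eq_iff)
qed

lemma faces_at_edge: "f \<in> F \<Longrightarrow> e \<in> cycle_edges (B f) \<Longrightarrow> v \<in> e \<Longrightarrow> f \<in> faces_at v"
  using Union_bd[of f] by (auto simp: faces_at_def)

lemma two_faces:
  assumes "e \<in> H" "f1 \<in> F" "f2 \<in> F" "f1 \<noteq> f2" "e \<in> cycle_edges (B f1)" "e \<in> cycle_edges (B f2)"
    "f \<in> F" "e \<in> cycle_edges (B f)"
  shows "f = f1 \<or> f = f2"
proof -
  let ?Fe = "{f \<in> F. e \<in> cycle_edges (B f)}"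
  have "{f1, f2} = ?Fe"
    using face_systemD(7)[OF fs assms(1)] assms finite_HF(2) by (intro card_seteq) auto
  moreover have "f \<in> ?Fe"
    using assms by simp
  ultimately show ?thesis
    by auto
qed

lemma other_face:
  assumes "f \<in> F" "e \<in> cycle_edges (B f)"
  obtains f' where "f' \<in> F" "f' \<noteq> f" "e \<in> cycle_edges (B f')"
proof -
  have "card {f \<in> F. e \<in> cycle_edges (B f)} = 2"
    using assms bd(3) face_systemD(7)[OF fs] by blast
  moreover have "f \<in> {f \<in> F. e \<in> cycle_edges (B f)}"
    using assms by simp
  ultimately obtain f' where f': "{f \<in> F. e \<in> cycle_edges (B f)} = {f, f'}" "f \<noteq> f'"
    by (rule card_2_other)
  then have "f' \<in> {f \<in> F. e \<in> cycle_edges (B f)}"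
    by simp
  then show thesis
    using that f'(2) by (metis (no_types, lifting) mem_Collect_eq)
qed

text \<open>Takes the place of walking once around \<open>v\<close>: an edge lies on two faces only,
  so no face can link an edge of \<open>S\<close> to one outside \<open>S\<close>.\<close>

lemma closed_star:
  assumes "S \<noteq> {}" "S \<subseteq> star v"
    and "\<And>e. e \<in> S \<Longrightarrow> \<exists>f1\<in>F. \<exists>f2\<in>F. f1 \<noteq> f2 \<and> e \<in> cycle_edges (B f1) \<and> e \<in> cycle_edges (B f2) \<and>
      corner v f1 \<subseteq> S \<and> corner v f2 \<subseteq> S"
  shows "S = star v"
proof (rule ccontr)
  assume "S \<noteq> star v"
  then have "S \<subseteq> {e \<in> H. v \<in> e}" "S \<noteq> {e \<in> H. v \<in> e}"
    using assms(2) by (simp_all add: star_def)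
  from face_system_link[OF fs this(1) assms(1) this(2)]
  obtain f e e' where f: "f \<in> F" "e \<in> cycle_edges (B f)" "e' \<in> cycle_edges (B f)" "e \<in> S" "v \<in> e'" "e' \<notin> S" .
  obtain f1 f2 where f12: "f1 \<in> F" "f2 \<in> F" "f1 \<noteq> f2" "e \<in> cycle_edges (B f1)" "e \<in> cycle_edges (B f2)"
      "corner v f1 \<subseteq> S" "corner v f2 \<subseteq> S"
    using assms(3)[OF f(4)] by metis
  have "e \<in> H"
    using f(1,2) bd(3) by auto
  then have "f = f1 \<or> f = f2"
    using two_faces f12 f by metis
  moreover have "e' \<in> corner v f"
    using f by (simp add: corner_def)
  ultimately show False
    using f12(6,7) f(6) by auto
qed

text \<open>Two faces with the same two edges at \<open>v\<close> already close up around
  \<open>v\<close>.\<close>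

lemma same_corner:
  assumes "f \<in> faces_at v" "f' \<in> faces_at v" "f \<noteq> f'" "corner v f = corner v f'"
  shows "d v = 2"
proof -
  have F: "f \<in> F" "f' \<in> F"
    using assms by (auto simp: faces_at_def)
  have "corner v f = star v"
  proof (rule closed_star)
    show "corner v f \<noteq> {}"
      using card_corner[OF assms(1)] by auto
    show "\<exists>f1\<in>F. \<exists>f2\<in>F. f1 \<noteq> f2 \<and> e \<in> cycle_edges (B f1) \<and> e \<in> cycle_edges (B f2) \<and>
      corner v f1 \<subseteq> corner v f \<and> corner v f2 \<subseteq> corner v f" if "e \<in> corner v f" for e
    proof (rule bexI[of _ f], rule bexI[of _ f'], intro conjI)
      show "e \<in> cycle_edges (B f)"
        using that by (simp add: corner_def)
      show "e \<in> cycle_edges (B f')"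
        using that unfolding assms(4) by (simp add: corner_def)
    qed (use assms F in simp_all)
  qed (rule corner_subset[OF F(1)])
  then show ?thesis
    using card_corner[OF assms(1)] card_star by simp
qed

section \<open>Triangular and quadrangular faces sharing edges\<close>

lemma triangle_face:
  assumes "f \<in> F" "length (B f) = 3" "{a, b} \<in> cycle_edges (B f)"
  obtains c where "distinct [a, b, c]" "set (B f) = {a, b, c}" "cycle_edges (B f) = {{a, b}, {b, c}, {c, a}}"
proof -
  obtain ys where ys: "cycle_edges (B f) = cycle_edges (a # b # ys)" "distinct (a # b # ys)"
    "set (B f) = set (a # b # ys)" "length (B f) = length (a # b # ys)"
    using cycle_edges_starting_with[OF assms(3) bd(1,2)[OF assms(1)]] by metis
  have "length ys = Suc 0"
    using ys(4) assms(2) by simp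
  then obtain c where "ys = [c]"
    by (auto simp: length_Suc_conv)
  then show thesis
    using that[of c] ys by (simp add: cycle_edges_def)
qed

lemma square_face:
  assumes "f \<in> F" "length (B f) = 4" "{a, b} \<in> cycle_edges (B f)"
  obtains y z where "distinct [a, b, y, z]" "cycle_edges (B f) = {{a, b}, {b, y}, {y, z}, {z, a}}"
proof -
  obtain ys where ys: "cycle_edges (B f) = cycle_edges (a # b # ys)" "distinct (a # b # ys)"
    "length (B f) = length (a # b # ys)"
    using cycle_edges_starting_with[OF assms(3) bd(1,2)[OF assms(1)]] by metis
  have "length ys = 2"
    using ys(3) assms(2) by simp
  then obtain y z where "ys = [y, z]"
    by (auto simp: numeral_2_eq_2 length_Suc_conv)
  then show thesis
    using that[of y z] ys by (simp add: cycle_edges_def)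
qed

lemma no_pentagon:
  assumes "distinct [a1, a2, a3, a4, a5]"
    "{a1, a2} \<in> H" "{a2, a3} \<in> H" "{a3, a4} \<in> H" "{a4, a5} \<in> H" "{a5, a1} \<in> H"
  shows False
proof -
  have "cycle_edges [a1, a2, a3, a4, a5] \<subseteq> H"
    using assms(2-6) by (simp add: cycle_edges_def)
  then show False
    using has_cycle_of_lengthI[OF assms(1)] noC5 by (simp add: eval_nat_numeral)
qed

lemma length_ne_5: "f \<in> F \<Longrightarrow> length (B f) \<noteq> 5"
  using has_cycle_of_lengthI[OF bd(1,3), of f] noC5 by auto

text \<open>Triangle \<open>a b c\<close> and quadrangle \<open>a b y z\<close> form the 5-cycle
  \<open>a c b y z\<close>, unless \<open>c\<close> is \<open>y\<close> or \<open>z\<close>. Then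
  the two faces have the same two edges at \<open>b\<close> or at \<open>a\<close>, which must have
  degree 2.\<close>

lemma triangle_square:
  assumes t: "t \<in> F" "length (B t) = 3" and q: "q \<in> F" "length (B q) = 4"
    and e: "e \<in> cycle_edges (B t)" "e \<in> cycle_edges (B q)"
    and deg: "\<And>v. v \<in> set (B t) \<Longrightarrow> d v \<noteq> 2"
  shows False
proof -
  have "e \<in> H"
    using bd(3)[OF t(1)] e(1) by auto
  then obtain a b where ab: "e = {a, b}"
    using edge by (metis card_2_iff)
  obtain c where c: "distinct [a, b, c]" "set (B t) = {a, b, c}" "cycle_edges (B t) = {{a, b}, {b, c}, {c, a}}"
    using triangle_face[OF t] e(1) ab by metis
  obtain y z where yz: "distinct [a, b, y, z]" "cycle_edges (B q) = {{a, b}, {b, y}, {y, z}, {z, a}}"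
    using square_face[OF q] e(2) ab by metis
  have tq: "t \<noteq> q"
    using t q by auto
  have at: "t \<in> faces_at v" "q \<in> faces_at v" if "v \<in> e" for v
    using that e faces_at_edge t(1) q(1) by metis+
  have "c \<noteq> y"
  proof
    assume "c = y"
    have "corner b t = {{a, b}, {b, c}}"
      using c(1) unfolding corner_def c(3) by auto
    moreover have "corner b q = {{a, b}, {b, c}}"
      using yz(1) unfolding corner_def yz(2) \<open>c = y\<close> by auto
    ultimately have "d b = 2"
      using same_corner[OF at[of b] tq] ab by simp
    then show False
      using deg[of b] c(2) by simp
  qed
  moreover have "c \<noteq> z"
  proof
    assume "c = z"
    have "corner a t = {{a, b}, {c, a}}"
      using c(1) unfolding corner_def c(3) by auto
    moreover have "corner a q = {{a, b}, {c, a}}"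
      using yz(1) unfolding corner_def yz(2) \<open>c = z\<close> by auto
    ultimately have "d a = 2"
      using same_corner[OF at[of a] tq] ab by simp
    then show False
      using deg[of a] c(2) by simp
  qed
  ultimately have "distinct [a, c, b, y, z]"
    using c(1) yz(1) by auto
  moreover have "{a, c} \<in> H" "{c, b} \<in> H"
    using bd(3)[OF t(1)] unfolding c(3) by (simp_all add: insert_commute)
  moreover have "{b, y} \<in> H" "{y, z} \<in> H" "{z, a} \<in> H"
    using bd(3)[OF q(1)] unfolding yz(2) by simp_all
  ultimately show False
    by (rule no_pentagon)
qed

text \<open>Three faces meeting cyclically in \<open>e1\<close>, \<open>e2\<close>,
  \<open>e3\<close> close up around \<open>v\<close>, so no further edge fits in.\<close>

lemma star_3:
  assumes "t1 \<in> F" "t2 \<in> F" "t3 \<in> F" "t1 \<noteq> t2" "t2 \<noteq> t3" "t1 \<noteq> t3"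
    and "corner v t1 = {e1, e2}" "corner v t2 = {e2, e3}" "corner v t3 = {e3, e1}"
  shows "d v \<le> 3"
proof -
  have e: "e1 \<in> corner v t1" "e1 \<in> corner v t3" "e2 \<in> corner v t1" "e2 \<in> corner v t2" "e3 \<in> corner v t2" "e3 \<in> corner v t3"
    using assms by simp_all
  then have cyc: "e1 \<in> cycle_edges (B t1)" "e1 \<in> cycle_edges (B t3)" "e2 \<in> cycle_edges (B t1)"
    "e2 \<in> cycle_edges (B t2)" "e3 \<in> cycle_edges (B t2)" "e3 \<in> cycle_edges (B t3)"
    by (simp_all add: corner_def)
  let ?S = "{e1, e2, e3}"
  have sub: "corner v t1 \<subseteq> ?S" "corner v t2 \<subseteq> ?S" "corner v t3 \<subseteq> ?S"
    using assms by auto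
  have "?S = star v"
  proof (rule closed_star)
    show "?S \<subseteq> star v"
      using e corner_subset assms(1-3) by blast
    show "\<exists>f1\<in>F. \<exists>f2\<in>F. f1 \<noteq> f2 \<and> e \<in> cycle_edges (B f1) \<and> e \<in> cycle_edges (B f2) \<and>
      corner v f1 \<subseteq> ?S \<and> corner v f2 \<subseteq> ?S" if "e \<in> ?S" for e
      using that
    proof (elim insertE emptyE)
      assume "e = e1"
      then show ?thesis
        using assms(1-6) cyc sub by (intro bexI[of _ t1] bexI[of _ t3]) simp_all
    next
      assume "e = e2"
      then show ?thesis
        using assms(1-6) cyc sub by (intro bexI[of _ t1] bexI[of _ t2]) simp_all
    next
      assume "e = e3"
      then show ?thesis
        using assms(1-6) cyc sub by (intro bexI[of _ t2] bexI[of _ t3]) simp_all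
    qed
  qed simp
  then have "d v = card ?S"
    using card_star by simp
  also have "\<dots> \<le> 3"
    by (simp add: card_insert_if)
  finally show ?thesis .
qed

lemma triangle_corner:
  assumes "f \<in> F" "length (B f) = 3" "{v, a} \<in> cycle_edges (B f)"
  obtains b where "distinct [v, a, b]" "corner v f = {{v, a}, {v, b}}" "{a, b} \<in> H" "{v, b} \<in> cycle_edges (B f)"
    "{v, b} \<in> H"
proof -
  obtain b where b: "distinct [v, a, b]" "cycle_edges (B f) = {{v, a}, {a, b}, {b, v}}"
    using triangle_face[OF assms] by metis
  moreover have "corner v f = {{v, a}, {v, b}}"
    using b(1) unfolding corner_def b(2) by auto
  moreover have "{v, b} \<in> cycle_edges (B f)"
    unfolding b(2) by (simp add: insert_commute)
  moreover from this have "{a, b} \<in> H" "{v, b} \<in> H"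
    using bd(3)[OF assms(1)] b(2) by auto
  ultimately show thesis
    by (intro that)
qed

text \<open>The outer triangles have third vertices \<open>c\<close> and \<open>e\<close>, and
  \<open>v c a b e\<close> is a 5-cycle unless \<open>c = e\<close>. In that case the three
  triangles close up around \<open>v\<close> and leave it degree 3.\<close>

lemma three_triangles:
  assumes "4 \<le> d v"
    and t: "t \<in> F" "length (B t) = 3" "corner v t = {{v, a}, {v, b}}" "distinct [v, a, b]" "{a, b} \<in> H"
    and t1: "t1 \<in> F" "t1 \<noteq> t" "length (B t1) = 3" "{v, a} \<in> cycle_edges (B t1)"
    and t2: "t2 \<in> F" "t2 \<noteq> t" "length (B t2) = 3" "{v, b} \<in> cycle_edges (B t2)"
  shows False
proof -
  obtain c where c: "distinct [v, a, c]" "corner v t1 = {{v, a}, {v, c}}" "{a, c} \<in> H" "{v, c} \<in> H"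
    using triangle_corner[OF t1(1,3,4)] by metis
  obtain e where e: "distinct [v, b, e]" "corner v t2 = {{v, b}, {v, e}}" "{b, e} \<in> H" "{v, e} \<in> H"
    using triangle_corner[OF t2(1,3,4)] by metis
  have at: "t \<in> faces_at v" "t1 \<in> faces_at v" "t2 \<in> faces_at v"
    using faces_at_edge[OF t1(1,4)] faces_at_edge[OF t2(1,4)] faces_at_edge[OF t(1), of "{v, a}" v] t(3)
    by (auto simp: corner_def)
  have "c \<noteq> b"
    using same_corner[OF at(2,1) t1(2)] c(2) t(3) assms(1) by auto
  have "e \<noteq> a"
    using same_corner[OF at(3,1) t2(2)] e(2) t(3) assms(1) by (auto simp: insert_commute)
  show False
  proof (cases "c = e")
    case True
    have "t1 \<noteq> t2"
    proof
      assume "t1 = t2"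
      have "{v, b} \<in> corner v t1"
        unfolding \<open>t1 = t2\<close> e(2) by simp
      then have "{v, b} \<in> {{v, a}, {v, c}}"
        unfolding c(2) .
      then show False
        using t(4) \<open>c \<noteq> b\<close> by (auto simp: doubleton_eq_iff)
    qed
    have "d v \<le> 3"
    proof (rule star_3[of t1 t t2])
      show "corner v t1 = {{v, c}, {v, a}}"
        using c(2) by (simp add: insert_commute)
    qed (use t t1 t2 e True \<open>t1 \<noteq> t2\<close> in simp_all)
    then show False
      using assms(1) by simp
  next
    case False
    have "distinct [v, c, a, b, e]"
      using False c(1) e(1) t(4) \<open>c \<noteq> b\<close> \<open>e \<noteq> a\<close> by auto
    then show False
      using c(3,4) e(3,4) t(5) by (intro no_pentagon[of v c a b e]) (simp_all add: insert_commute)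
  qed
qed

text \<open>If \<open>x\<close> has degree 2 in \<open>H\<close>, a triangle and a square may share an edge at \<open>x\<close>; the faces at \<open>x\<close>
  are then paid for by \<open>x\<close> alone.\<close>

definition excl :: "'f \<Rightarrow> bool" where
  "excl f \<longleftrightarrow> x \<in> set (B f) \<and> d x = 2"

text \<open>Chosen so that no vertex other than \<open>x\<close> pays anything to such a
  face.\<close>

definition zero :: "'f \<Rightarrow> bool" where
  "zero f \<longleftrightarrow> excl f \<or> 6 \<le> length (B f)"

lemma degree_ge_2: "v \<in> \<Union>H \<Longrightarrow> 2 \<le> d v"
proof -
  assume "v \<in> \<Union>H"
  then obtain e where e: "e \<in> H" "v \<in> e"
    by auto
  then obtain f where "f \<in> F" "e \<in> cycle_edges (B f)"
    using face_systemD(7)[OF fs e(1)] by (metis (no_types, lifting) card.empty empty_Collect_eq zero_neq_numeral)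
  then have "f \<in> F" "f \<in> faces_at v"
    using faces_at_edge e(2) by auto
  then show ?thesis
    using card_corner[of f v] card_mono[OF finite_star corner_subset[of f v]] card_star by simp
qed

text \<open>No vertex of \<open>t\<close> has degree 2, since \<open>t\<close> is not exclusive to
  \<open>x\<close>. So length 4 is excluded by the shared edge, length 5 by the missing 5-cycles,
  and larger lengths by \<open>\<not> zero f\<close>.\<close>

lemma neighbour_face:
  assumes t: "t \<in> F" "length (B t) = 3" "\<not> excl t"
    and f: "f \<in> F" "f \<noteq> t" "e \<in> cycle_edges (B t)" "e \<in> cycle_edges (B f)" "\<not> zero f"
  shows "length (B f) = 3"
proof -
  have "d v \<noteq> 2" if "v \<in> set (B t)" for v
  proof (cases "v = x")
    case True
    then show ?thesis
      using t(3) that by (simp add: excl_def)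
  next
    case False
    have "v \<in> \<Union>H"
      using that Union_bd[OF t(1)] bd(3)[OF t(1)] by auto
    then show ?thesis
      using deg3[of v] False by simp
  qed
  then have "length (B f) \<noteq> 4"
    using triangle_square[OF t(1,2) f(1) _ f(3,4)] by metis
  then show ?thesis
    using bd(2)[OF f(1)] length_ne_5[OF f(1)] f(5) by (simp add: zero_def)
qed

text \<open>Across \<open>{v, a}\<close> comes a second triangle \<open>f1\<close>, and the face
  \<open>f3\<close> beyond it cannot be a third consecutive triangle. If \<open>f3\<close> were
  \<open>f2\<close>, the faces \<open>t\<close>, \<open>f2\<close>, \<open>f1\<close> would close up
  around \<open>v\<close> and give degree at most 3.\<close>

lemma zero_from_one_side:
  assumes "4 \<le> d v"
    and t: "t \<in> F" "length (B t) = 3" "\<not> excl t" "corner v t = {{v, a}, {v, b}}" "distinct [v, a, b]" "{a, b} \<in> H"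
    and f1: "f1 \<in> F" "f1 \<noteq> t" "{v, a} \<in> cycle_edges (B f1)" "\<not> zero f1"
    and f2: "f2 \<in> F" "f2 \<noteq> t" "{v, b} \<in> cycle_edges (B f2)" "zero f2"
  obtains f3 where "f3 \<in> faces_at v" "zero f3" "f3 \<noteq> f2"
proof -
  have vat: "{v, a} \<in> cycle_edges (B t)"
    using t(4) by (auto simp: corner_def)
  have l1: "length (B f1) = 3"
    using neighbour_face[OF t(1-3) f1(1,2) vat f1(3,4)] .
  have "\<not> excl f1"
    using f1(4) by (simp add: zero_def)
  obtain c where c: "distinct [v, a, c]" "corner v f1 = {{v, a}, {v, c}}" "{a, c} \<in> H" "{v, c} \<in> cycle_edges (B f1)"
    using triangle_corner[OF f1(1) l1 f1(3)] by metis
  have at: "t \<in> faces_at v" "f1 \<in> faces_at v" "f2 \<in> faces_at v"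
    using faces_at_edge[OF t(1) vat] faces_at_edge[OF f1(1,3)] faces_at_edge[OF f2(1,3)] by simp_all
  have "c \<noteq> b"
    using same_corner[OF at(2,1) f1(2)] c(2) t(4) assms(1) by auto
  obtain f3 where f3: "f3 \<in> F" "f3 \<noteq> f1" "{v, c} \<in> cycle_edges (B f3)"
    using other_face[OF f1(1) c(4)] by metis
  have f3v: "f3 \<in> faces_at v"
    using faces_at_edge[OF f3(1,3)] by simp
  have "zero f3"
  proof (rule ccontr)
    assume nz: "\<not> zero f3"
    have l3: "length (B f3) = 3"
      using neighbour_face[OF f1(1) l1 \<open>\<not> excl f1\<close> f3(1,2) c(4) f3(3) nz] .
    show False
      using three_triangles[OF assms(1) f1(1) l1 c(2,1,3) t(1) f1(2)[symmetric] t(2) vat f3(1,2) l3 f3(3)] .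
  qed
  moreover have "f3 \<noteq> f2"
  proof
    assume "f3 = f2"
    have "{v, b} \<noteq> {v, c}"
      using \<open>c \<noteq> b\<close> by (auto simp: doubleton_eq_iff)
    moreover have "{{v, b}, {v, c}} \<subseteq> corner v f2"
      using f2(3) f3(3) \<open>f3 = f2\<close> by (simp add: corner_def)
    moreover have "finite (corner v f2)"
      by (simp add: corner_def)
    ultimately have "{{v, b}, {v, c}} = corner v f2"
      using card_corner[OF at(3)] by (intro card_seteq) simp_all
    then have cf2: "corner v f2 = {{v, b}, {v, c}}" ..
    have "d v \<le> 3"
    proof (rule star_3[of t f2 f1])
      show "f2 \<noteq> f1"
        using f3(2) \<open>f3 = f2\<close> by simp
      show "corner v t = {{v, a}, {v, b}}" "corner v f2 = {{v, b}, {v, c}}" "corner v f1 = {{v, c}, {v, a}}"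
        using t(4) cf2 c(2) by (simp_all add: insert_commute)
    qed (use t(1) f1(1,2) f2(1,2) in simp_all)
    then show False
      using assms(1) by simp
  qed
  ultimately show thesis
    using that f3v by metis
qed

text \<open>Walking from \<open>t\<close> around \<open>v\<close> in both directions, one meets a
  \<open>zero\<close> face after at most one further triangle, and a further triangle cannot occur
  on both sides.\<close>

lemma two_zero_faces:
  assumes "4 \<le> d v" and t: "t \<in> faces_at v" "length (B t) = 3" "\<not> excl t"
  obtains f1 f2 where "f1 \<in> faces_at v" "f2 \<in> faces_at v" "f1 \<noteq> f2" "zero f1" "zero f2"
proof -
  have tF: "t \<in> F" and vt: "v \<in> set (B t)"
    using t(1) by (auto simp: faces_at_def)
  obtain a where "{v, a} \<in> cycle_edges (B t)"
    using cycle_edges_at[OF bd(1,2)[OF tF] vt] by (metis (no_types, lifting) insertI1 mem_Collect_eq)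
  then obtain b where ab: "distinct [v, a, b]" "corner v t = {{v, a}, {v, b}}" "{a, b} \<in> H" "{v, b} \<in> cycle_edges (B t)"
    and va: "{v, a} \<in> cycle_edges (B t)"
    using triangle_corner[OF tF t(2)] by metis
  obtain f1 where f1: "f1 \<in> F" "f1 \<noteq> t" "{v, a} \<in> cycle_edges (B f1)"
    using other_face[OF tF va] by metis
  obtain f2 where f2: "f2 \<in> F" "f2 \<noteq> t" "{v, b} \<in> cycle_edges (B f2)"
    using other_face[OF tF ab(4)] by metis
  have at: "f1 \<in> faces_at v" "f2 \<in> faces_at v"
    using faces_at_edge[OF f1(1,3)] faces_at_edge[OF f2(1,3)] by simp_all
  have "f1 \<noteq> f2"
  proof
    assume "f1 = f2"
    have "{v, a} \<noteq> {v, b}"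
      using ab(1) by (auto simp: doubleton_eq_iff)
    moreover have "{{v, a}, {v, b}} \<subseteq> corner v f1"
      using f1(3) f2(3) \<open>f1 = f2\<close> by (simp add: corner_def)
    moreover have "finite (corner v f1)"
      by (simp add: corner_def)
    ultimately have "{{v, a}, {v, b}} = corner v f1"
      using card_corner[OF at(1)] by (intro card_seteq) simp_all
    then have "d v = 2"
      using same_corner[OF at(1) t(1) f1(2)] ab(2) by simp
    then show False
      using assms(1) by simp
  qed
  have ba: "corner v t = {{v, b}, {v, a}}" "distinct [v, b, a]" "{b, a} \<in> H"
    using ab by (auto simp: insert_commute)
  consider "zero f1" "zero f2" | "\<not> zero f1" "zero f2" | "zero f1" "\<not> zero f2" | "\<not> zero f1" "\<not> zero f2"
    by argo
  then show thesis
  proof cases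
    case 1
    then show thesis
      using that at \<open>f1 \<noteq> f2\<close> by metis
  next
    case 2
    obtain f3 where "f3 \<in> faces_at v" "zero f3" "f3 \<noteq> f2"
      using zero_from_one_side[OF assms(1) tF t(2,3) ab(2,1,3) f1 2(1) f2 2(2)] by metis
    then show thesis
      using that at(2) 2(2) by metis
  next
    case 3
    obtain f3 where "f3 \<in> faces_at v" "zero f3" "f3 \<noteq> f1"
      using zero_from_one_side[OF assms(1) tF t(2,3) ba f2 3(2) f1 3(1)] by metis
    then show thesis
      using that at(1) 3(1) by metis
  next
    case 4
    have "length (B f1) = 3" "length (B f2) = 3"
      using neighbour_face[OF tF t(2,3) f1(1,2) va f1(3) 4(1)] neighbour_face[OF tF t(2,3) f2(1,2) ab(4) f2(3) 4(2)] .
    then show thesis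
      using three_triangles[OF assms(1) tF t(2) ab(2,1,3) f1(1,2) _ f1(3) f2(1,2) _ f2(3)] by metis
  qed
qed

section \<open>Charges paid to faces and the final balance\<close>

definition rich :: "'v \<Rightarrow> bool" where
  "rich v \<longleftrightarrow> v = x \<or> 6 \<le> d v"

text \<open>The charge that the face \<open>f\<close> receives from its vertex \<open>v\<close>; initially \<open>v\<close> has charge
  \<open>2 * d v - 6\<close> and \<open>f\<close> has charge \<open>length (B f) - 6\<close>.\<close>

definition w :: "'v \<Rightarrow> 'f \<Rightarrow> real" where
  "w v f =
    (if length (B f) = 3 then
       if excl f then if v = x then 3 else 0 else if rich v then 3/2 else if d v = 3 then 0 else 1
     else if length (B f) = 4 then
       if excl f then if v = x then 2 else 0 else if rich v then 1 else if d v = 3 then 0 else 1/2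
     else 0)"

lemma w_nonneg: "0 \<le> w v f"
  by (simp add: w_def)

text \<open>Rich vertices pay half of the need of a face, other vertices of degree not 3 an equal
  share: a third of 3 or a quarter of 2. A vertex of degree 3 other than \<open>x\<close> pays
  nothing, but both its neighbours on the face are rich; this is why \<open>x\<close> counts as rich
  whatever its degree.\<close>

lemma face_charge:
  assumes f: "f \<in> F"
  shows "6 - real (length (B f)) \<le> (\<Sum>v\<in>set (B f). w v f)"
proof -
  have nn: "0 \<le> (\<Sum>v\<in>set (B f). w v f)"
    by (intro sum_nonneg w_nonneg)
  have card: "card (set (B f)) = length (B f)"
    using bd(1)[OF f] by (rule distinct_card)
  show ?thesis
  proof (cases "length (B f) = 3 \<or> length (B f) = 4")
    case False
    then have "6 \<le> length (B f)"
      using bd(2)[OF f] length_ne_5[OF f] by linarith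
    then show ?thesis
      using nn by linarith
  next
    case len: True
    show ?thesis
    proof (cases "excl f")
      case True
      then have "x \<in> set (B f)"
        by (simp add: excl_def)
      then have "w x f \<le> (\<Sum>v\<in>set (B f). w v f)"
        by (intro member_le_sum) (simp_all add: w_nonneg)
      moreover have "w x f = 6 - real (length (B f))"
        using True len by (auto simp: w_def)
      ultimately show ?thesis
        by simp
    next
      case nexcl: False
      show ?thesis
      proof (cases "\<exists>u\<in>set (B f). u \<noteq> x \<and> d u = 3")
        case True
        then obtain u where u: "u \<in> set (B f)" "u \<noteq> x" "d u = 3"
          by auto
        obtain a b where ab: "a \<noteq> b" "a \<in> set (B f)" "b \<in> set (B f)"
            "{e \<in> cycle_edges (B f). u \<in> e} = {{u, a}, {u, b}}"
          using cycle_edges_at[OF bd(1,2)[OF f] u(1)] by metis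
        have "{u, a} \<in> {e \<in> cycle_edges (B f). u \<in> e}" "{u, b} \<in> {e \<in> cycle_edges (B f). u \<in> e}"
          unfolding ab(4) by simp_all
        then have "{u, a} \<in> H" "{u, b} \<in> H"
          using bd(3)[OF f] by auto
        then have "rich a" "rich b"
          using heavy u(2,3) by (simp_all add: rich_def)
        then have "w a f + w b f \<ge> 6 - real (length (B f))"
          using len nexcl by (auto simp: w_def)
        moreover have "w a f + w b f = (\<Sum>v\<in>{a, b}. w v f)"
          using ab(1) by simp
        moreover have "(\<Sum>v\<in>{a, b}. w v f) \<le> (\<Sum>v\<in>set (B f). w v f)"
          using ab by (intro sum_mono2) (simp_all add: w_nonneg)
        ultimately show ?thesis
          by linarith
      next
        case False
        have "(6 - real (length (B f))) / real (length (B f)) \<le> w v f" if "v \<in> set (B f)" for v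
        proof -
          have "rich v \<or> d v \<noteq> 3"
            using False that by (auto simp: rich_def)
          then show ?thesis
            using len nexcl by (auto simp: w_def)
        qed
        then have "real (card (set (B f))) * ((6 - real (length (B f))) / real (length (B f))) \<le> (\<Sum>v\<in>set (B f). w v f)"
          by (intro sum_bounded_below)
        moreover have "real (length (B f)) \<noteq> 0"
          using len by auto
        ultimately show ?thesis
          unfolding card by simp
      qed
    qed
  qed
qed

text \<open>Incidences of edges and faces at \<open>v\<close> are counted twice: each face at
  \<open>v\<close> has two edges there, and each edge lies on two faces.\<close>

lemma card_faces_at:
  assumes "v \<in> \<Union>H"
  shows "card (faces_at v) = d v"
proof -
  have "2 * card (faces_at v) = (\<Sum>f\<in>faces_at v. 2)"
    by simp
  also have "\<dots> = (\<Sum>f\<in>faces_at v. card (corner v f))"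
    using card_corner by simp
  also have "\<dots> = (\<Sum>f\<in>F. card (corner v f))"
  proof (rule sum.mono_neutral_left)
    show "\<forall>f\<in>F - faces_at v. card (corner v f) = 0"
    proof
      fix f assume "f \<in> F - faces_at v"
      then have "corner v f = {}"
        using faces_at_edge[of f _ v] by (auto simp: corner_def)
      then show "card (corner v f) = 0"
        by simp
    qed
  qed (use finite_HF in \<open>auto simp: faces_at_def\<close>)
  also have "\<dots> = (\<Sum>f\<in>F. card {e \<in> star v. e \<in> cycle_edges (B f)})"
  proof (rule sum.cong)
    fix f assume "f \<in> F"
    then have "corner v f = {e \<in> star v. e \<in> cycle_edges (B f)}"
      using bd(3)[of f] by (auto simp: corner_def star_def)
    then show "card (corner v f) = card {e \<in> star v. e \<in> cycle_edges (B f)}"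
      by simp
  qed simp
  also have "\<dots> = (\<Sum>e\<in>star v. card {f \<in> F. e \<in> cycle_edges (B f)})"
    using finite_HF(2) finite_star by (rule double_count)
  also have "\<dots> = (\<Sum>e\<in>star v. 2)"
    using face_systemD(7)[OF fs] by (intro sum.cong) (simp_all add: star_def)
  also have "\<dots> = 2 * d v"
    using card_star by simp
  finally show ?thesis
    by simp
qed

lemma finite_faces_at: "finite (faces_at v)"
  using finite_HF(2) by (simp add: faces_at_def)

text \<open>With a triangle to pay for, two faces at \<open>v\<close> are free, and
  \<open>d - 2 \<le> 2 * d - 6\<close> holds from \<open>d = 4\<close>,
  \<open>3/2 * (d - 2) \<le> 2 * d - 6\<close> from \<open>d = 6\<close>. Otherwise quadrangles cost
  at most \<open>d/2\<close> or, for rich \<open>v\<close>, \<open>d\<close>. All four bounds are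
  attained at \<open>d = 4\<close> or \<open>d = 6\<close>.\<close>

lemma vertex_charge:
  assumes v: "v \<in> \<Union>H" "v \<noteq> x"
  shows "(\<Sum>f\<in>faces_at v. w v f) \<le> 2 * real (d v) - 6"
proof (cases "d v = 3")
  case True
  then have "w v f = 0" for f
    using v(2) by (simp add: w_def rich_def)
  then show ?thesis
    using True by simp
next
  case False
  then have d4: "4 \<le> d v"
    using deg3[OF v] by simp
  have rich: "rich v \<longleftrightarrow> 6 \<le> d v"
    using v(2) by (simp add: rich_def)
  show ?thesis
  proof (cases "\<exists>t\<in>faces_at v. length (B t) = 3 \<and> \<not> excl t")
    case True
    then obtain f1 f2 where f12: "f1 \<in> faces_at v" "f2 \<in> faces_at v" "f1 \<noteq> f2" "zero f1" "zero f2"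
      using two_zero_faces[OF d4] by metis
    have "w v f1 = 0" "w v f2 = 0"
      using f12(4,5) v(2) by (auto simp: zero_def w_def)
    then have "(\<Sum>f\<in>faces_at v. w v f) = (\<Sum>f\<in>faces_at v - {f1, f2}. w v f)"
      using finite_faces_at by (intro sum.mono_neutral_right) auto
    also have "\<dots> \<le> real (card (faces_at v - {f1, f2})) * (if 6 \<le> d v then 3/2 else 1)"
    proof (rule sum_bounded_above)
      show "w v f \<le> (if 6 \<le> d v then 3/2 else 1)" for f
        using v(2) unfolding w_def rich by simp
    qed
    also have "card (faces_at v - {f1, f2}) = d v - 2"
      using f12(1-3) finite_faces_at card_faces_at[OF v(1)] by (subst card_Diff_subset) auto
    also have "real (d v - 2) = real (d v) - 2"
      using d4 by (simp add: of_nat_diff)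
    also have "(real (d v) - 2) * (if 6 \<le> d v then 3/2 else 1) \<le> 2 * real (d v) - 6"
      using d4 by (auto simp: field_simps)
    finally show ?thesis .
  next
    case False
    have "(\<Sum>f\<in>faces_at v. w v f) \<le> real (card (faces_at v)) * (if 6 \<le> d v then 1 else 1/2)"
    proof (rule sum_bounded_above)
      fix f assume "f \<in> faces_at v"
      then have "\<not> (length (B f) = 3 \<and> \<not> excl f)"
        using False by auto
      then show "w v f \<le> (if 6 \<le> d v then 1 else 1/2)"
        using v(2) unfolding w_def rich by auto
    qed
    also have "\<dots> \<le> 2 * real (d v) - 6"
      using d4 card_faces_at[OF v(1)] by (auto simp: field_simps)
    finally show ?thesis .
  qed
qed

text \<open>The constant 8 comes from \<open>d x = 2\<close>, where two triangles may cost 3 each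
  while the charge of \<open>x\<close> is -2. For larger degree
  \<open>3/2 * d \<le> 2 * d + 2\<close> suffices.\<close>

lemma special_charge:
  assumes "x \<in> \<Union>H"
  shows "(\<Sum>f\<in>faces_at x. w x f) \<le> 2 * real (d x) - 6 + 8"
proof -
  have "(\<Sum>f\<in>faces_at x. w x f) \<le> real (card (faces_at x)) * (if d x = 2 then 3 else 3/2)"
    by (rule sum_bounded_above) (simp add: w_def rich_def excl_def)
  also have "\<dots> \<le> 2 * real (d x) - 6 + 8"
    using degree_ge_2[OF assms] card_faces_at[OF assms] by auto
  finally show ?thesis .
qed

lemma impossible: False
proof -
  let ?V = "\<Union>H"
  have "(\<Sum>v\<in>?V. d v) = (\<Sum>e\<in>H. card {v \<in> ?V. v \<in> e})"
    unfolding vdegree_def using double_count[OF finite_verts finite_HF(1)] .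
  also have "\<dots> = (\<Sum>e\<in>H. 2)"
  proof (rule sum.cong)
    fix e assume "e \<in> H"
    moreover from this have "{v \<in> ?V. v \<in> e} = e"
      by auto
    ultimately show "card {v \<in> ?V. v \<in> e} = 2"
      using edge by simp
  qed simp
  finally have sumd: "(\<Sum>v\<in>?V. d v) = 2 * card H"
    by simp
  have "(\<Sum>f\<in>F. length (B f)) = (\<Sum>f\<in>F. card {e \<in> H. e \<in> cycle_edges (B f)})"
  proof (rule sum.cong)
    fix f assume f: "f \<in> F"
    have "{e \<in> H. e \<in> cycle_edges (B f)} = cycle_edges (B f)"
      using bd(3)[OF f] by auto
    then show "length (B f) = card {e \<in> H. e \<in> cycle_edges (B f)}"
      using card_cycle_edges[OF bd(1,2)[OF f]] by simp
  qed simp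
  also have "\<dots> = (\<Sum>e\<in>H. card {f \<in> F. e \<in> cycle_edges (B f)})"
    using finite_HF(2,1) by (rule double_count)
  also have "\<dots> = (\<Sum>e\<in>H. 2)"
    using face_systemD(7)[OF fs] by (rule sum.cong[OF refl])
  finally have sumf: "(\<Sum>f\<in>F. length (B f)) = 2 * card H"
    by simp
  have verts: "set (B f) = {v \<in> ?V. v \<in> set (B f)}" if "f \<in> F" for f
    using Union_bd[OF that] bd(3)[OF that] by auto
  have "(\<Sum>f\<in>F. 6 - real (length (B f))) \<le> (\<Sum>f\<in>F. \<Sum>v\<in>set (B f). w v f)"
    by (intro sum_mono face_charge)
  also have "\<dots> = (\<Sum>f\<in>F. \<Sum>v\<in>{v \<in> ?V. v \<in> set (B f)}. w v f)"
    using verts by (intro sum.cong) auto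
  also have "\<dots> = (\<Sum>v\<in>?V. \<Sum>f\<in>faces_at v. w v f)"
    unfolding faces_at_def using finite_HF(2) finite_verts by (rule sum.swap_restrict)
  also have "\<dots> \<le> (\<Sum>v\<in>?V. 2 * real (d v) - 6 + (if v = x then 8 else 0))"
    using vertex_charge special_charge by (intro sum_mono) auto
  also have "\<dots> \<le> (\<Sum>v\<in>?V. 2 * real (d v) - 6) + 8"
    using finite_verts by (simp add: sum.distrib)
  also have "(\<Sum>v\<in>?V. 2 * real (d v) - 6) = 2 * real (\<Sum>v\<in>?V. d v) - 6 * real (card ?V)"
    by (simp add: sum_subtractf sum_distrib_left)
  also have "(\<Sum>f\<in>F. 6 - real (length (B f))) = 6 * real (card F) - real (\<Sum>f\<in>F. length (B f))"
    by (simp add: sum_subtractf)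
  finally have "6 * (real (card F) + real (card ?V)) \<le> 6 * real (card H) + 8"
    using sumd sumf by simp
  \<comment> \<open>Euler's formula makes the left side \<open>6 * card H + 12\<close>, too large by
    4.\<close>
  moreover have "real (card F + card ?V) = real (card H + 2)"
    using face_systemD(3)[OF fs] by simp
  ultimately show False
    by (simp only: of_nat_add) simp
qed

end

section \<open>From a plane drawing to a light edge and the colouring theorem\<close>

lemma (in plane_graph) ear_built_plane_faces: "ear_built E H \<Longrightarrow> \<exists>F B. plane_faces H F B"
proof (induction rule: ear_built.induct)
  case (cycle xs)
  then show ?case
    by (rule plane_faces_cycle)
next
  case (ear H p ps q)
  then show ?case
    using plane_faces_ear by metis
qed

lemma planar_subset:
  assumes "planar V E" "E' \<subseteq> E"
  shows "planar V E'"
proof -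
  obtain p g where "plane_drawing V E p g"
    using assms(1) by (auto simp: planar_def)
  note pd = this[unfolded plane_drawing_def]
  have "plane_drawing V E' p g"
    unfolding plane_drawing_def
  proof (rule conjI[OF pd[THEN conjunct1] conjI])
    show "\<forall>e\<in>E'. arc (g e) \<and> {pathstart (g e), pathfinish (g e)} = p ` e \<and> path_image (g e) \<inter> p ` V = p ` e"
      using pd[THEN conjunct2, THEN conjunct1] assms(2) by (intro ballI) (erule (1) bspec[OF _ subsetD])
    show "\<forall>e\<in>E'. \<forall>e'\<in>E'. e \<noteq> e' \<longrightarrow> path_image (g e) \<inter> path_image (g e') \<subseteq> p ` (e \<inter> e')"
      using pd[THEN conjunct2, THEN conjunct2] assms(2) by (meson subsetD)
  qed
  then show ?thesis
    by (auto simp: planar_def)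
qed

lemma has_cycle_of_length_mono:
  assumes "has_cycle_of_length n E'" "E' \<subseteq> E"
  shows "has_cycle_of_length n E"
proof -
  obtain vs where "length vs = n" "distinct vs" "\<forall>i<n. {vs ! i, vs ! (Suc i mod n)} \<in> E'"
    using assms(1) by (auto simp: has_cycle_of_length_def)
  then show ?thesis
    unfolding has_cycle_of_length_def using assms(2) by (intro exI[of _ vs]) auto
qed

lemma planar_no_pentagon_light_edge:
  assumes graph: "simple_graph V E" and "planar V E" "\<not> has_cycle_of_length 5 E" "E \<noteq> {}"
  shows "\<exists>u v. {u, v} \<in> E \<and> u \<noteq> v \<and> vdegree E u \<le> 3 \<and> (vdegree E u = 3 \<longrightarrow> vdegree E v \<le> 5)"
proof (rule ccontr)
  assume contra: "\<not> ?thesis"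
  have edges: "card e = 2" "e \<subseteq> V" if "e \<in> E" for e
    using graph that by (auto simp: simple_graph_def)
  have "finite V"
    using graph by (simp add: simple_graph_def)
  then have "finite E"
    using edges(2) by (meson PowI finite_Pow_iff finite_subset subsetI)
  have deg: "3 \<le> vdegree E v" if v: "v \<in> \<Union>E" for v
  proof -
    obtain e where e: "e \<in> E" "v \<in> e"
      using v by auto
    obtain w where "e = {v, w}" "v \<noteq> w"
      using card_2_other[OF edges(1)[OF e(1)] e(2)] by metis
    then have "\<not> (vdegree E v \<le> 3 \<and> (vdegree E v = 3 \<longrightarrow> vdegree E w \<le> 5))"
      using contra e(1) by auto
    then show ?thesis
      by linarith
  qed
  obtain H x where H: "ear_built E H" and full: "\<And>v. v \<in> \<Union>H \<Longrightarrow> v \<noteq> x \<Longrightarrow> {e \<in> E. v \<in> e} \<subseteq> H"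
    using ex_end_block[OF \<open>finite E\<close> assms(4) edges(1) deg] by metis
  have HE: "H \<subseteq> E"
    using ear_built_subset[OF H] .
  obtain pos crv where "plane_drawing V E pos crv"
    using assms(2) by (auto simp: planar_def)
  then interpret plane_graph V E pos crv
    using graph by unfold_locales
  obtain F B where "plane_faces H F B"
    using ear_built_plane_faces[OF H] by blast
  then have "face_system H F B"
    by (simp add: plane_faces_def)
  \<comment> \<open>Away from \<open>x\<close> the block contains every edge of the graph at its
    vertices, so the degree conditions carry over to \<open>H\<close>.\<close>
  have degH: "vdegree H v = vdegree E v" if "v \<in> \<Union>H" "v \<noteq> x" for v
  proof -
    have "{e \<in> H. v \<in> e} = {e \<in> E. v \<in> e}"
      using full[OF that] HE by auto
    then show ?thesis
      by (simp add: vdegree_def)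
  qed
  interpret discharging H F B x
  proof
    show "face_system H F B"
      by fact
    show "card e = 2" if "e \<in> H" for e
      using that HE edges(1) by auto
    show "3 \<le> vdegree H v" if "v \<in> \<Union>H" "v \<noteq> x" for v
      using degH[OF that] deg[of v] that(1) HE by auto
    show "v = x \<or> 6 \<le> vdegree H v" if uv: "{u, v} \<in> H" "u \<noteq> x" "vdegree H u = 3" for u v
    proof (cases "v = x")
      case False
      have "u \<noteq> v"
        using edges(1)[of "{u, v}"] uv(1) HE by auto
      moreover have "vdegree E u = 3" "vdegree H v = vdegree E v"
        using degH[of u] degH[of v] uv False by auto
      moreover have "{u, v} \<in> E"
        using uv(1) HE by auto
      ultimately have "\<not> vdegree H v \<le> 5"
        using contra by fastforce
      then show ?thesis
        by simp
    qed simp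
    show "\<not> has_cycle_of_length 5 H"
      using assms(3) has_cycle_of_length_mono[OF _ HE] by auto
  qed
  show False
    by (rule impossible)
qed

theorem theorem14:
  fixes V :: "'v set" and E :: "'v set set" and k :: nat
  assumes "k \<ge> 6"
    and "simple_graph V E"
    and "planar V E"
    and "max_degree V E \<le> k"
    and "\<not> has_cycle_of_length 5 E"
  shows "total_group_choice_number TYPE('a) V E \<le> enat (k + 2)"
proof -
  have "finite V" and edges: "\<And>e. e \<in> E \<Longrightarrow> e \<subseteq> V"
    using assms(2) by (auto simp: simple_graph_def)
  then have "finite E"
    by (meson PowI finite_Pow_iff finite_subset subsetI)
  have "group_choosable TYPE('a) (k + 2) (total_verts V E) (total_edges E)"
  proof (rule total_group_choosable[OF assms(2)])
    fix E' assume E': "E' \<subseteq> E" "E' \<noteq> {}"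
    have "simple_graph V E'" "planar V E'" "\<not> has_cycle_of_length 5 E'"
      using assms(2) E'(1) planar_subset[OF assms(3) E'(1)] assms(5) has_cycle_of_length_mono[OF _ E'(1)]
      by (auto simp: simple_graph_def)
    then obtain u v where uv: "{u, v} \<in> E'" "u \<noteq> v" "vdegree E' u \<le> 3" "vdegree E' u = 3 \<longrightarrow> vdegree E' v \<le> 5"
      using planar_no_pentagon_light_edge E'(2) by metis
    have "vdegree E' v \<le> vdegree E v"
      unfolding vdegree_def using \<open>finite E\<close> E'(1) by (intro card_mono) auto
    also have "\<dots> \<le> max_degree V E"
      unfolding max_degree_def using \<open>finite V\<close> edges[of "{u, v}"] uv(1) E'(1) by (intro Max_ge) auto
    finally have "vdegree E' v \<le> k"
      using assms(4) by simp
    \<comment> \<open>For \<open>d(u) = 3\<close> the demands are \<open>6 < k + 2\<close> and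
      \<open>3 + 5 \<le> k + 2\<close>, the second being exactly \<open>k \<ge> 6\<close>. For
      \<open>d(u) \<le> 2\<close> the bound on the maximum degree gives
      \<open>d(u) + d(v) \<le> 2 + k\<close>.\<close>
    then have "2 * vdegree E' u < k + 2" "vdegree E' u + vdegree E' v \<le> k + 2"
      using uv(3,4) assms(1) by linarith+
    then show "\<exists>u v. {u, v} \<in> E' \<and> u \<noteq> v \<and> 2 * vdegree E' u < k + 2 \<and> vdegree E' u + vdegree E' v \<le> k + 2"
      using uv(1,2) by blast
  qed simp
  then show ?thesis
    unfolding total_group_choice_number_def group_choice_number_def by (intro Inf_lower) auto
qed

end
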